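(* Let $\mathbb{K}$ be a non-archimedean field that is complete with respect to its non-trivial valuation, and let $X$ be a Fréchet space over $\mathbb{K}$. Then $X$ is normable if and only if every closed subspace of $X$ that has a Schauder basis is normable.
   Context: All locally convex spaces are Hausdorff and over $\mathbb{K}$, with topology generated by non-archimedean seminorms, i.e. seminorms $p$ satisfying $p(x+y)\le\max\{p(x),p(y)\}$ and $p(ax)=|a|p(x)$. A Fréchet space is a complete metrizable locally convex space. A locally convex space is normable if its topology is generated by a (non-archimedean) norm. A sequence $(x_n)$ in a locally convex space $E$ is a Schauder basis of $E$ if each $x\in E$ can be written uniquely as $x=\sum_{n} a_nx_n$ with $(a_n)\subset\mathbb{K}$, and the coefficient functionals $x_n^*:E\to\mathbb{K}$, $x\mapsto a_n$, are continuous for all $n$. A closed subspace carries the induced topology. *)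

theory Defs
  imports "HOL-Analysis.Analysis"
begin

definition nonarch_valuation :: "('k::field \<Rightarrow> real) \<Rightarrow> bool" where
  "nonarch_valuation v \<longleftrightarrow>
     (\<forall>x. 0 \<le> v x) \<and> (\<forall>x. v x = 0 \<longleftrightarrow> x = 0) \<and>
     (\<forall>x y. v (x * y) = v x * v y) \<and>
     (\<forall>x y. v (x + y) \<le> max (v x) (v y))"

definition complete_nonarch_field :: "('k::field \<Rightarrow> real) \<Rightarrow> bool" where
  "complete_nonarch_field v \<longleftrightarrow>
     nonarch_valuation v \<and> (\<exists>x. x \<noteq> 0 \<and> v x \<noteq> 1) \<and>
     Metric_space.mcomplete UNIV (\<lambda>x y. v (x - y))"

definition valuation_topology :: "('k::field \<Rightarrow> real) \<Rightarrow> 'k topology" where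
  "valuation_topology v = Metric_space.mtopology UNIV (\<lambda>x y. v (x - y))"

text \<open>
  Spaces are given by a topology \<open>T\<close> whose carrier \<open>topspace T\<close> is a linear subspace of an
  ambient vector space, so that a subspace \<open>D\<close> with its induced topology is
  \<open>subtopology T D\<close>. Seminorms on \<open>E\<close> are functions on the ambient type, constrained on \<open>E\<close> only.
\<close>

definition nonarch_seminorm_on ::
  "('k::field \<Rightarrow> real) \<Rightarrow> ('k \<Rightarrow> 'a::ab_group_add \<Rightarrow> 'a) \<Rightarrow> 'a set \<Rightarrow> ('a \<Rightarrow> real) \<Rightarrow> bool" where
  "nonarch_seminorm_on v scl E p \<longleftrightarrow>
     (\<forall>x\<in>E. 0 \<le> p x) \<and>
     (\<forall>x\<in>E. \<forall>y\<in>E. p (x + y) \<le> max (p x) (p y)) \<and>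
     (\<forall>a. \<forall>x\<in>E. p (scl a x) = v a * p x)"

definition nonarch_norm_on ::
  "('k::field \<Rightarrow> real) \<Rightarrow> ('k \<Rightarrow> 'a::ab_group_add \<Rightarrow> 'a) \<Rightarrow> 'a set \<Rightarrow> ('a \<Rightarrow> real) \<Rightarrow> bool" where
  "nonarch_norm_on v scl E p \<longleftrightarrow>
     nonarch_seminorm_on v scl E p \<and> (\<forall>x\<in>E. p x = 0 \<longrightarrow> x = 0)"

text \<open>The open balls form a subbasis; \<open>E\<close> itself is inserted to cover the case \<open>P = {}\<close>.\<close>

definition seminorm_topology :: "'a::ab_group_add set \<Rightarrow> ('a \<Rightarrow> real) set \<Rightarrow> 'a topology" where
  "seminorm_topology E P =
     topology_generated_by
       (insert E {{y \<in> E. p (y - x) < r} | p x r. p \<in> P \<and> x \<in> E \<and> 0 < r})"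

lemma topspace_seminorm_topology [simp]: "topspace (seminorm_topology E P) = E"
  unfolding seminorm_topology_def topology_generated_by_topspace by auto

definition locally_convex_space ::
  "('k::field \<Rightarrow> real) \<Rightarrow> ('k \<Rightarrow> 'a::ab_group_add \<Rightarrow> 'a) \<Rightarrow> 'a topology \<Rightarrow> bool" where
  "locally_convex_space v scl T \<longleftrightarrow>
     vector_space scl \<and> module.subspace scl (topspace T) \<and> Hausdorff_space T \<and>
     (\<exists>P. (\<forall>p\<in>P. nonarch_seminorm_on v scl (topspace T) p) \<and>
          T = seminorm_topology (topspace T) P)"

text \<open>Completeness for the translation-invariant uniformity: every Cauchy filter converges.\<close>

definition cauchy_filter_in :: "'a::ab_group_add topology \<Rightarrow> 'a filter \<Rightarrow> bool" where
  "cauchy_filter_in T F \<longleftrightarrow>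
     F \<noteq> bot \<and> F \<le> principal (topspace T) \<and>
     (\<forall>U. openin T U \<and> 0 \<in> U \<longrightarrow>
        (\<exists>A. eventually (\<lambda>x. x \<in> A) F \<and> (\<forall>x\<in>A. \<forall>y\<in>A. x - y \<in> U)))"

definition complete_tvs :: "'a::ab_group_add topology \<Rightarrow> bool" where
  "complete_tvs T \<longleftrightarrow> (\<forall>F. cauchy_filter_in T F \<longrightarrow> (\<exists>l. limitin T (\<lambda>x. x) l F))"

definition frechet_space ::
  "('k::field \<Rightarrow> real) \<Rightarrow> ('k \<Rightarrow> 'a::ab_group_add \<Rightarrow> 'a) \<Rightarrow> 'a topology \<Rightarrow> bool" where
  "frechet_space v scl T \<longleftrightarrow>
     locally_convex_space v scl T \<and> metrizable_space T \<and> complete_tvs T"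

definition normable ::
  "('k::field \<Rightarrow> real) \<Rightarrow> ('k \<Rightarrow> 'a::ab_group_add \<Rightarrow> 'a) \<Rightarrow> 'a topology \<Rightarrow> bool" where
  "normable v scl T \<longleftrightarrow>
     (\<exists>p. nonarch_norm_on v scl (topspace T) p \<and> T = seminorm_topology (topspace T) {p})"

definition series_represents ::
  "('k::field \<Rightarrow> 'a::ab_group_add \<Rightarrow> 'a) \<Rightarrow> 'a topology \<Rightarrow> (nat \<Rightarrow> 'a) \<Rightarrow> (nat \<Rightarrow> 'k) \<Rightarrow> 'a \<Rightarrow> bool" where
  "series_represents scl T e a x \<longleftrightarrow>
     limitin T (\<lambda>N. \<Sum>n<N. scl (a n) (e n)) x sequentially"

definition coefficient_functional ::
  "('k::field \<Rightarrow> 'a::ab_group_add \<Rightarrow> 'a) \<Rightarrow> 'a topology \<Rightarrow> (nat \<Rightarrow> 'a) \<Rightarrow> nat \<Rightarrow> 'a \<Rightarrow> 'k" where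
  "coefficient_functional scl T e n x = (THE a. series_represents scl T e a x) n"

definition schauder_basis ::
  "('k::field \<Rightarrow> real) \<Rightarrow> ('k \<Rightarrow> 'a::ab_group_add \<Rightarrow> 'a) \<Rightarrow> 'a topology \<Rightarrow> (nat \<Rightarrow> 'a) \<Rightarrow> bool" where
  "schauder_basis v scl T e \<longleftrightarrow>
     range e \<subseteq> topspace T \<and>
     (\<forall>x\<in>topspace T. \<exists>!a. series_represents scl T e a x) \<and>
     (\<forall>n. continuous_map T (valuation_topology v) (coefficient_functional scl T e n))"

end

theory Submission imports Defs begin

text \<open>
  Write the topology of a Frechet space \<open>X\<close> by an increasing sequence of seminorms \<open>q\<^sub>0 \<le> q\<^sub>1 \<le> \<dots>\<close>. Then
  \<open>X\<close> is normable iff a single \<open>q\<^sub>k\<close> dominates every \<open>q\<^sub>j\<close> up to a constant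
  (\<open>normable_fundamental_iff\<close>). This condition passes to subspaces, which is the easy implication.
  For the converse, a non-normable \<open>X\<close> must be shown to contain a sequence \<open>(e\<^sub>n)\<close> that is a Schauder
  basis of its closed span and along which no \<open>q\<^sub>k\<close> dominates all the others.

  Being a basis is guaranteed by almost orthogonality: if adding a multiple of \<open>e\<^sub>n\<close> to a vector \<open>f\<close> of
  \<open>span {e\<^sub>0, \<dots>, e\<^sub>n\<^sub>-\<^sub>1}\<close> can shrink \<open>q\<^sub>i f\<close>, for \<open>i \<le> n\<close>, by a factor \<open>t\<^sub>n\<close> at most, where the
  product of the \<open>t\<^sub>n\<close> converges, then the partial sum operators are uniformly bounded
  (\<open>partial_sum_bound\<close>), and every vector of the closed span has an expansion with continuous
  coefficients (\<open>schauder_basis_closed_span\<close>). It remains to find such a sequence.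

  If no \<open>q\<^sub>k\<close> is a norm, one takes \<open>e\<^sub>n\<close> in the kernel of \<open>q\<^sub>n\<close>, after passing to a subsequence of
  seminorms; orthogonality is then trivial, and the closed span is a copy of the space of all scalar
  sequences (\<open>nonnormable_no_norm_case\<close>).

  Otherwise all \<open>q\<^sub>k\<close> may be taken to be norms. One works in a subspace \<open>L\<close> of countable dimension that
  already witnesses non-normability. The point of countable dimension is that functionals on subspaces
  of \<open>L\<close> extend to \<open>L\<close> with an arbitrarily small increase of their norm
  (\<open>extend_functional_countable\<close>); over a field that is not spherically complete this fails in
  general. Consequently all vectors in a suitable intersection of finitely many kernels of continuous
  functionals on \<open>L\<close> are almost orthogonal to a given finite-dimensional subspace
  (\<open>ex_orthogonal_kernel\<close>). What is left is to find, for each \<open>k\<close>, an index \<open>j\<close> such that \<open>q\<^sub>k\<close> fails to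
  dominate \<open>q\<^sub>j\<close> on each such intersection, with \<open>j\<close> independent of the functionals
  (\<open>ex_undominated_on_finite_codimension\<close>). This is where completeness of \<open>X\<close> enters: if
  there were no such \<open>j\<close>, the topology of \<open>L\<close> would be given by \<open>q\<^sub>k\<close> together with a sequence of functionals, and a
  Mittag-Leffler argument would produce a Cauchy sequence in \<open>L\<close> tending to zero for \<open>q\<^sub>k\<close> on which
  one of the functionals is a nonzero constant; its limit would be a nonzero vector with \<open>q\<^sub>k = 0\<close>.
\<close>

section \<open>Scalars and seminorms\<close>

text \<open>The set \<open>E\<close> is the carrier of the space under study, a subspace of the ambient type. Varying it
  lets the same lemmas speak about a space and about its subspaces with the induced topology.\<close>

locale nonarch_space = vector_space scl
  for scl :: "'k::field \<Rightarrow> 'a::ab_group_add \<Rightarrow> 'a" (infixr \<open>\<odot>\<close> 75) +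
  fixes v :: "'k \<Rightarrow> real" and E :: "'a set"
  assumes complete_field: "complete_nonarch_field v"
    and subspace_E: "subspace E"
begin

lemma valuation_nonneg [simp]: "0 \<le> v a"
  and valuation_eq_0_iff [simp]: "v a = 0 \<longleftrightarrow> a = 0"
  and valuation_mult: "v (a * b) = v a * v b"
  and valuation_add: "v (a + b) \<le> max (v a) (v b)"
  using complete_field unfolding complete_nonarch_field_def nonarch_valuation_def by blast+

lemma valuation_pos: "a \<noteq> 0 \<Longrightarrow> 0 < v a"
  using valuation_nonneg[of a] valuation_eq_0_iff[of a] by linarith

lemma valuation_zero [simp]: "v 0 = 0"
  by simp

lemma valuation_one [simp]: "v 1 = 1"
  using valuation_mult[of 1 1] valuation_eq_0_iff[of 1] by simp

lemma valuation_minus_one: "v (- 1) = 1"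
proof -
  have "v (- 1) * v (- 1) = 1"
    using valuation_mult[of "- 1" "- 1"] by simp
  then have "(v (- 1))\<^sup>2 = 1\<^sup>2" by (simp add: power2_eq_square)
  then show ?thesis
    using valuation_nonneg[of "- 1"] by (metis power2_eq_imp_eq zero_le_one)
qed

lemma valuation_minus [simp]: "v (- a) = v a"
  using valuation_mult[of "- 1" a] valuation_minus_one by simp

lemma valuation_minus_commute: "v (a - b) = v (b - a)"
  using valuation_minus[of "a - b"] by simp

lemma valuation_inverse: "v (inverse a) = inverse (v a)"
proof (cases "a = 0")
  case False
  then have "v a * v (inverse a) = 1"
    using valuation_mult[of a "inverse a"] by simp
  then show ?thesis
    by (metis inverse_unique)
qed simp

lemma valuation_power: "v (a ^ n) = v a ^ n"
  by (induction n) (simp_all add: valuation_mult)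

lemma valuation_powi: "v (a powi n) = v a powi n"
  by (simp add: power_int_def valuation_power valuation_inverse)

lemma obtain_uniformizer:
  obtains c where "1 < v c"
proof -
  obtain x where x: "x \<noteq> 0" "v x \<noteq> 1"
    using complete_field unfolding complete_nonarch_field_def by blast
  show ?thesis
  proof (cases "1 < v x")
    case False
    then have "1 < v (inverse x)"
      using x valuation_pos[of x] by (simp add: valuation_inverse one_less_inverse)
    then show ?thesis by (rule that)
  qed (rule that)
qed

text \<open>The value group need not be all of the positive reals, so a vector can be scaled to a prescribed size
  only up to a bounded factor \<open>B\<close>. A power of a scalar of value \<open>B > 1\<close> does it.\<close>
lemma rescaling:
  "\<exists>B>1. \<forall>y>0. \<forall>s>0. \<exists>a. a \<noteq> 0 \<and> s \<le> v a * y \<and> v a * y < B * s"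
proof -
  obtain c where c: "1 < v c" by (rule obtain_uniformizer)
  have "\<exists>a. a \<noteq> 0 \<and> s \<le> v a * y \<and> v a * y < v c * s" if "0 < y" "0 < s" for y s
  proof -
    define m where "m = \<lceil>log (v c) (s / y)\<rceil>"
    have "s / y = v c powr log (v c) (s / y)"
      using c that by (simp add: powr_log_cancel)
    moreover have "v c powr real_of_int m = v c powi m"
      using c by (intro powr_real_of_int') auto
    moreover have "v c powr log (v c) (s / y) \<le> v c powr real_of_int m"
      using c by (intro powr_mono) (auto simp: m_def)
    ultimately have 1: "s / y \<le> v c powi m" by simp
    have "v c powr real_of_int m < v c powr (1 + log (v c) (s / y))"
    proof (rule powr_less_mono)
      show "real_of_int m < 1 + log (v c) (s / y)"
        unfolding m_def by linarith
    qed (use c in auto)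
    also have "\<dots> = v c * (s / y)"
      using c that by (simp add: powr_add powr_log_cancel)
    finally have 2: "v c powi m < v c * (s / y)"
      using c powr_real_of_int'[of "v c" m] by fastforce
    have "c \<noteq> 0" using c by auto
    then have "c powi m \<noteq> 0" by simp
    moreover have "s \<le> v (c powi m) * y" "v (c powi m) * y < v c * s"
      using 1 2 that by (simp_all add: valuation_powi field_simps)
    ultimately show ?thesis by blast
  qed
  then show ?thesis using c by blast
qed

lemma Metric_space_valuation: "Metric_space UNIV (\<lambda>a b. v (a - b))"
proof
  fix a b c
  show "v (a - b) = v (b - a)" by (rule valuation_minus_commute)
  have "v (a - c) \<le> max (v (a - b)) (v (b - c))"
    using valuation_add[of "a - b" "b - c"] by simp
  then show "v (a - c) \<le> v (a - b) + v (b - c)"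
    using valuation_nonneg[of "a - b"] valuation_nonneg[of "b - c"] by linarith
qed simp_all

lemma field_Cauchy_convergent:
  assumes "\<And>\<epsilon>. 0 < \<epsilon> \<Longrightarrow> \<exists>N. \<forall>m\<ge>N. \<forall>n\<ge>N. v (c m - c n) < \<epsilon>"
  obtains l where "(\<lambda>n. v (c n - l)) \<longlonglongrightarrow> 0"
proof -
  interpret M: Metric_space UNIV "\<lambda>a b. v (a - b)" by (rule Metric_space_valuation)
  have "M.mcomplete"
    using complete_field unfolding complete_nonarch_field_def by blast
  moreover have "M.MCauchy c"
    unfolding M.MCauchy_def using assms by (metis subset_UNIV)
  ultimately obtain l where l: "limitin M.mtopology c l sequentially"
    unfolding M.mcomplete_def by blast
  have "(\<lambda>n. v (c n - l)) \<longlonglongrightarrow> 0"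
    using l unfolding M.limit_metric_sequentially by (simp add: LIMSEQ_iff)
  then show ?thesis by (rule that)
qed

lemma continuous_map_valuation:
  assumes "\<And>x \<epsilon>. x \<in> topspace T \<Longrightarrow> 0 < \<epsilon> \<Longrightarrow>
      \<exists>U. openin T U \<and> x \<in> U \<and> (\<forall>y\<in>U. v (f y - f x) < \<epsilon>)"
  shows "continuous_map T (valuation_topology v) f"
proof -
  interpret M: Metric_space UNIV "\<lambda>a b. v (a - b)" by (rule Metric_space_valuation)
  have "continuous_map T M.mtopology f"
    unfolding M.continuous_map_to_metric
  proof (intro ballI allI impI)
    fix x \<epsilon> assume "x \<in> topspace T" "0 < (\<epsilon>::real)"
    then obtain U where "openin T U" "x \<in> U" "\<forall>y\<in>U. v (f y - f x) < \<epsilon>"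
      using assms by blast
    then show "\<exists>U. openin T U \<and> x \<in> U \<and> (\<forall>y\<in>U. f y \<in> M.mball (f x) \<epsilon>)"
      by (auto simp: M.in_mball valuation_minus_commute)
  qed
  then show ?thesis unfolding valuation_topology_def .
qed

abbreviation seminorm :: "('a \<Rightarrow> real) \<Rightarrow> bool" where
  "seminorm \<equiv> nonarch_seminorm_on v scl E"

lemma zero_in_E [simp]: "0 \<in> E"
  and add_in_E: "x \<in> E \<Longrightarrow> y \<in> E \<Longrightarrow> x + y \<in> E"
  and scale_in_E: "x \<in> E \<Longrightarrow> a \<odot> x \<in> E"
  and diff_in_E: "x \<in> E \<Longrightarrow> y \<in> E \<Longrightarrow> x - y \<in> E"
  and minus_in_E: "x \<in> E \<Longrightarrow> - x \<in> E"
  using subspace_E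
  by (auto simp: subspace_0 subspace_add subspace_scale subspace_diff subspace_neg)

context
  fixes p assumes p: "seminorm p"
begin

lemma seminorm_nonneg: "x \<in> E \<Longrightarrow> 0 \<le> p x"
  and seminorm_add: "x \<in> E \<Longrightarrow> y \<in> E \<Longrightarrow> p (x + y) \<le> max (p x) (p y)"
  and seminorm_scale: "x \<in> E \<Longrightarrow> p (a \<odot> x) = v a * p x"
  using p unfolding nonarch_seminorm_on_def by auto

lemma seminorm_zero: "p 0 = 0"
  using seminorm_scale[of 0 0] by simp

lemma seminorm_minus: "x \<in> E \<Longrightarrow> p (- x) = p x"
  using seminorm_scale[of x "- 1"] by (simp add: valuation_minus_one)

lemma seminorm_minus_commute: "x \<in> E \<Longrightarrow> y \<in> E \<Longrightarrow> p (x - y) = p (y - x)"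
  using seminorm_minus[of "x - y"] by (simp add: diff_in_E)

lemma seminorm_diff: "x \<in> E \<Longrightarrow> y \<in> E \<Longrightarrow> p (x - y) \<le> max (p x) (p y)"
  using seminorm_add[of x "- y"] by (simp add: minus_in_E seminorm_minus)

lemma seminorm_triangle:
  "x \<in> E \<Longrightarrow> y \<in> E \<Longrightarrow> z \<in> E \<Longrightarrow> p (x - z) \<le> max (p (x - y)) (p (y - z))"
  using seminorm_add[of "x - y" "y - z"] by (simp add: diff_in_E)

lemma seminorm_le_max_diff: "x \<in> E \<Longrightarrow> y \<in> E \<Longrightarrow> p x \<le> max (p (x - y)) (p y)"
  using seminorm_add[of "x - y" y] by (simp add: diff_in_E)

end

definition dominated_on :: "'a set \<Rightarrow> ('a \<Rightarrow> real) \<Rightarrow> ('a \<Rightarrow> real) \<Rightarrow> bool" where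
  "dominated_on S q p \<longleftrightarrow> (\<exists>C. \<forall>x\<in>S. q x \<le> C * p x)"

lemma dominated_onE:
  assumes "dominated_on S q p" "seminorm p" "S \<subseteq> E"
  obtains C where "0 < C" "\<And>x. x \<in> S \<Longrightarrow> q x \<le> C * p x"
proof -
  obtain C where C: "\<And>x. x \<in> S \<Longrightarrow> q x \<le> C * p x"
    using assms(1) unfolding dominated_on_def by blast
  have "q x \<le> max 1 C * p x" if "x \<in> S" for x
  proof -
    have "q x \<le> C * p x" using C that by blast
    also have "\<dots> \<le> max 1 C * p x"
      using that assms seminorm_nonneg by (intro mult_right_mono) auto
    finally show ?thesis .
  qed
  then show ?thesis using that[of "max 1 C"] by simp
qed

lemma dominated_on_mono: "dominated_on S q p \<Longrightarrow> S' \<subseteq> S \<Longrightarrow> dominated_on S' q p"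
  unfolding dominated_on_def by blast

text \<open>If \<open>q x\<close> exceeded \<open>B * s / r * p x\<close>, then \<open>x\<close> could be rescaled so that \<open>q\<close> is at least \<open>s\<close> while
  \<open>p\<close> stays below \<open>r\<close>.\<close>
lemma dominated_on_of_balls:
  assumes p: "seminorm p" and q: "seminorm q" and "0 < r" "0 < s"
    and sub: "\<And>x. x \<in> E \<Longrightarrow> p x < r \<Longrightarrow> q x < s"
  shows "dominated_on E q p"
proof -
  obtain B where B: "1 < B"
    "\<forall>y>0. \<forall>s>0. \<exists>a. a \<noteq> 0 \<and> s \<le> v a * y \<and> v a * y < B * s"
    using rescaling by blast
  have "q x \<le> (B * s / r) * p x" if x: "x \<in> E" for x
  proof (rule ccontr)
    assume "\<not> ?thesis"
    then have less: "(B * s / r) * p x < q x" by simp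
    moreover have "0 \<le> (B * s / r) * p x"
      using B assms x seminorm_nonneg by simp
    ultimately have "0 < q x" by linarith
    then obtain a where a: "a \<noteq> 0" "s \<le> v a * q x" "v a * q x < B * s"
      using B(2) \<open>0 < s\<close> by blast
    have "v a * ((B * s / r) * p x) < v a * q x"
      using less valuation_pos[OF a(1)] by (rule mult_strict_left_mono)
    then have "(B * s) * (v a * p x) / r < B * s"
      using a(3) by (simp add: algebra_simps)
    then have "v a * p x < r"
      using B(1) \<open>0 < r\<close> \<open>0 < s\<close> by (simp add: divide_less_eq)
    then have "p (a \<odot> x) < r" using x p by (simp add: seminorm_scale)
    then have "q (a \<odot> x) < s" using sub x by (simp add: scale_in_E)
    then show False using a(2) q x by (simp add: seminorm_scale)
  qed
  then show ?thesis unfolding dominated_on_def by blast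
qed

section \<open>Fundamental sequences of seminorms\<close>

text \<open>By the ultrametric inequality a ball is also a ball around each of its points; finite intersections of
  balls around \<open>x\<close> are therefore a neighbourhood base at \<open>x\<close>.\<close>
lemma openin_seminorm_topology:
  assumes P: "\<And>p. p \<in> P \<Longrightarrow> seminorm p"
  shows "openin (seminorm_topology E P) U \<longleftrightarrow>
    U \<subseteq> E \<and> (\<forall>x\<in>U. \<exists>A r. finite A \<and> A \<subseteq> P \<and> 0 < r \<and> {y \<in> E. \<forall>p\<in>A. p (y - x) < r} \<subseteq> U)"
    (is "_ \<longleftrightarrow> ?R U")
proof
  assume U: "openin (seminorm_topology E P) U"
  define G where "G = insert E {{y \<in> E. p (y - x) < r} | p x r. p \<in> P \<and> x \<in> E \<and> 0 < (r::real)}"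
  have "generate_topology_on G U"
    using U unfolding seminorm_topology_def G_def by (rule openin_topology_generated_by)
  then show "?R U"
  proof (induction rule: generate_topology_on.induct)
    case (Int U V)
    show ?case
    proof (intro conjI ballI)
      fix x assume x: "x \<in> U \<inter> V"
      obtain A r where A: "finite A" "A \<subseteq> P" "0 < r" "{y \<in> E. \<forall>p\<in>A. p (y - x) < r} \<subseteq> U"
        using Int x by blast
      obtain B s where B: "finite B" "B \<subseteq> P" "0 < s" "{y \<in> E. \<forall>p\<in>B. p (y - x) < s} \<subseteq> V"
        using Int x by blast
      have "{y \<in> E. \<forall>p\<in>A \<union> B. p (y - x) < min r s} \<subseteq> U \<inter> V"
        using A(4) B(4) by auto
      moreover have "finite (A \<union> B)" "A \<union> B \<subseteq> P" "0 < min r s"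
        using A B by auto
      ultimately show "\<exists>A r. finite A \<and> A \<subseteq> P \<and> 0 < r \<and>
          {y \<in> E. \<forall>p\<in>A. p (y - x) < r} \<subseteq> U \<inter> V"
        by blast
    qed (use Int in blast)
  next
    case (UN K)
    show ?case
    proof (intro conjI ballI)
      fix x assume "x \<in> \<Union>K"
      then obtain k where k: "k \<in> K" "x \<in> k" by blast
      then obtain A r where "finite A" "A \<subseteq> P" "0 < r" "{y \<in> E. \<forall>p\<in>A. p (y - x) < r} \<subseteq> k"
        using UN.IH by meson
      then show "\<exists>A r. finite A \<and> A \<subseteq> P \<and> 0 < r \<and> {y \<in> E. \<forall>p\<in>A. p (y - x) < r} \<subseteq> \<Union>K"
        using k by (meson Sup_upper order_trans)
    qed (use UN in blast)
  next
    case (Basis U)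
    show ?case
    proof (cases "U = E")
      case True
      have "finite {} \<and> {} \<subseteq> P \<and> 0 < (1::real) \<and> {y \<in> E. \<forall>p\<in>{}. p (y - x) < 1} \<subseteq> U" for x
        using True by simp
      then show ?thesis using True by blast
    next
      case False
      then obtain p x0 r where U: "U = {y \<in> E. p (y - x0) < r}" "p \<in> P" "x0 \<in> E" "0 < r"
        using Basis unfolding G_def by auto
      have "{y \<in> E. \<forall>p'\<in>{p}. p' (y - x) < r} \<subseteq> U" if "x \<in> U" for x
        using that U seminorm_triangle[OF P[OF U(2)], of _ x x0] by (fastforce simp: U(1))
      moreover have "finite {p}" "{p} \<subseteq> P" using U by auto
      ultimately have "\<forall>x\<in>U. \<exists>A r. finite A \<and> A \<subseteq> P \<and> 0 < r \<and>
          {y \<in> E. \<forall>p\<in>A. p (y - x) < r} \<subseteq> U"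
        using U(4) by blast
      then show ?thesis using U(1) by blast
    qed
  qed simp
next
  assume R: "?R U"
  have basic: "openin (seminorm_topology E P) {y \<in> E. \<forall>p\<in>A. p (y - x) < r}"
    if "finite A" "A \<subseteq> P" "0 < r" "x \<in> E" for A x r
    using that
  proof (induction A rule: finite_induct)
    case empty
    have "openin (seminorm_topology E P) E"
      using openin_topspace[of "seminorm_topology E P"] by simp
    then show ?case by simp
  next
    case (insert p A)
    have "openin (seminorm_topology E P) {y \<in> E. p (y - x) < r}"
      unfolding seminorm_topology_def
      using insert.prems by (intro topology_generated_by_Basis) auto
    then have "openin (seminorm_topology E P)
        ({y \<in> E. p (y - x) < r} \<inter> {y \<in> E. \<forall>p\<in>A. p (y - x) < r})"
      using insert by (intro openin_Int) auto
    moreover have "{y \<in> E. p (y - x) < r} \<inter> {y \<in> E. \<forall>p\<in>A. p (y - x) < r}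
        = {y \<in> E. \<forall>p\<in>insert p A. p (y - x) < r}"
      by auto
    ultimately show ?case by simp
  qed
  show "openin (seminorm_topology E P) U"
  proof (subst openin_subopen, intro ballI)
    fix x assume x: "x \<in> U"
    then obtain A r where A: "finite A" "A \<subseteq> P" "0 < r" "{y \<in> E. \<forall>p\<in>A. p (y - x) < r} \<subseteq> U"
      using R by blast
    have "x \<in> E" using R x by blast
    moreover have "p (x - x) < r" if "p \<in> A" for p
      using A(2,3) that seminorm_zero[OF P, of p] by auto
    then have "x \<in> {y \<in> E. \<forall>p\<in>A. p (y - x) < r}"
      using \<open>x \<in> E\<close> by blast
    ultimately show "\<exists>V. openin (seminorm_topology E P) V \<and> x \<in> V \<and> V \<subseteq> U"
      using basic[OF A(1-3)] A(4) by blast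
  qed
qed

lemma openin_seminorm_topology_singleton:
  assumes p: "seminorm p"
  shows "openin (seminorm_topology E {p}) U \<longleftrightarrow>
    U \<subseteq> E \<and> (\<forall>x\<in>U. \<exists>r>0. {y \<in> E. p (y - x) < r} \<subseteq> U)"
proof -
  have "(\<exists>A r. finite A \<and> A \<subseteq> {p} \<and> 0 < r \<and> {y \<in> E. \<forall>p\<in>A. p (y - x) < r} \<subseteq> U)
    \<longleftrightarrow> (\<exists>r>0. {y \<in> E. p (y - x) < r} \<subseteq> U)" (is "?L \<longleftrightarrow> ?R") for x
  proof
    assume ?L
    then obtain A r where "A \<subseteq> {p}" "0 < r" "{y \<in> E. \<forall>p\<in>A. p (y - x) < r} \<subseteq> U" by blast
    then show ?R by (intro exI[of _ r]) auto
  next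
    assume ?R
    then obtain r where "0 < r" "{y \<in> E. p (y - x) < r} \<subseteq> U" by blast
    then show ?L by (intro exI[of _ "{p}"] exI[of _ r]) auto
  qed
  then show ?thesis
    using p by (subst openin_seminorm_topology) auto
qed

text \<open>The form in which a metrizable locally convex topology is used below: increasing seminorms, so that
  single balls, instead of finite intersections of balls, form neighbourhood bases.\<close>
definition fundamental :: "'a topology \<Rightarrow> (nat \<Rightarrow> 'a \<Rightarrow> real) \<Rightarrow> bool" where
  "fundamental T q \<longleftrightarrow> topspace T = E \<and> (\<forall>n. seminorm (q n)) \<and>
    (\<forall>n. \<forall>x\<in>E. q n x \<le> q (Suc n) x) \<and>
    (\<forall>U. openin T U \<longleftrightarrow> U \<subseteq> E \<and> (\<forall>x\<in>U. \<exists>n. \<exists>r>0. {y \<in> E. q n (y - x) < r} \<subseteq> U))"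

text \<open>Each metric ball of radius \<open>1 / (n + 1)\<close> around \<open>0\<close> contains a finite intersection of seminorm balls;
  \<open>q n\<close> is the maximum of the seminorms used up to stage \<open>n\<close>. Translation invariance of the locally
  convex topology carries the comparison from \<open>0\<close> to all points.\<close>
lemma ex_fundamental:
  assumes P: "\<And>p. p \<in> P \<Longrightarrow> seminorm p" and T: "T = seminorm_topology E P"
    and metr: "metrizable_space T"
  obtains q where "fundamental T q"
proof -
  have opn: "openin T U \<longleftrightarrow> U \<subseteq> E \<and> (\<forall>x\<in>U. \<exists>A r. finite A \<and> A \<subseteq> P \<and> 0 < r \<and>
      {y \<in> E. \<forall>p\<in>A. p (y - x) < r} \<subseteq> U)" for U
    unfolding T by (rule openin_seminorm_topology) (rule P)
  have topT: "topspace T = E" by (simp add: T)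
  obtain M d where "Metric_space M d" and Td: "T = Metric_space.mtopology M d"
    using metr unfolding metrizable_space_def by blast
  interpret M: Metric_space M d by fact
  have M: "M = E" using topT Td M.topspace_mtopology by simp
  define good where "good n A r \<longleftrightarrow> finite A \<and> A \<subseteq> P \<and> 0 < r \<and>
      {y \<in> E. \<forall>p\<in>A. p y < r} \<subseteq> M.mball 0 (1 / real (Suc n))" for n A r
  have "\<exists>A r. good n A r" for n
  proof -
    have "openin T (M.mball 0 (1 / real (Suc n)))" "0 \<in> M.mball 0 (1 / real (Suc n))"
      unfolding Td by (rule M.openin_mball, subst M.centre_in_mball_iff) (simp add: M)
    from bspec[OF conjunct2[OF iffD1[OF opn this(1)]] this(2)] show ?thesis
      by (simp add: good_def)
  qed
  then obtain A r where "\<And>n. good n (A n) (r n)" by metis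
  then have A: "\<And>n. finite (A n)" "\<And>n. A n \<subseteq> P" "\<And>n. 0 < r n"
    "\<And>n. {y \<in> E. \<forall>p\<in>A n. p y < r n} \<subseteq> M.mball 0 (1 / real (Suc n))"
    unfolding good_def by simp_all
  define B where "B n = (\<Union>i\<le>n. A i)" for n
  define q where "q n x = Max (insert 0 ((\<lambda>p. p x) ` B n))" for n x
  have finB: "finite (B n)" and BP: "B n \<subseteq> P" for n
    using A by (auto simp: B_def)
  have q_less: "q n x < s \<longleftrightarrow> 0 < s \<and> (\<forall>p\<in>B n. p x < s)" for n x s
    using finB by (auto simp: q_def)
  have q_le: "q n x \<le> s \<longleftrightarrow> 0 \<le> s \<and> (\<forall>p\<in>B n. p x \<le> s)" for n x s
    using finB by (auto simp: q_def)
  have q_in: "q n x \<in> insert 0 ((\<lambda>p. p x) ` B n)" for n x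
    unfolding q_def using finB by (intro Max_in) auto
  have q_ge: "0 \<le> q n x" "p \<in> B n \<Longrightarrow> p x \<le> q n x" for n x p
    using q_le[of n x "q n x"] by auto
  have semi: "seminorm (q n)" for n
    unfolding nonarch_seminorm_on_def
  proof (intro conjI ballI allI)
    fix x y assume xy: "x \<in> E" "y \<in> E"
    show "q n (x + y) \<le> max (q n x) (q n y)"
      unfolding q_le
    proof (intro conjI ballI)
      fix p assume p: "p \<in> B n"
      then have "p (x + y) \<le> max (p x) (p y)"
        using xy P BP seminorm_add by blast
      then show "p (x + y) \<le> max (q n x) (q n y)"
        using q_ge(2)[OF p, of x] q_ge(2)[OF p, of y] by linarith
    qed (use q_ge(1)[of n x] in linarith)
  next
    fix a x assume x: "x \<in> E"
    have sc: "p (a \<odot> x) = v a * p x" if "p \<in> B n" for p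
      using that x P BP seminorm_scale by blast
    show "q n (a \<odot> x) = v a * q n x"
    proof (rule antisym)
      show "q n (a \<odot> x) \<le> v a * q n x"
        unfolding q_le using q_ge by (auto simp: sc mult_left_mono)
      show "v a * q n x \<le> q n (a \<odot> x)"
        using q_in[of n x]
      proof
        assume "q n x \<in> (\<lambda>p. p x) ` B n"
        then obtain p where "p \<in> B n" "q n x = p x" by blast
        then show ?thesis using q_ge(2)[of p n "a \<odot> x"] by (simp add: sc)
      qed (simp add: q_ge)
    qed
  qed (rule q_ge)
  have "q n x \<le> q (Suc n) x" for n x
    unfolding q_le
  proof (intro conjI ballI)
    fix p assume "p \<in> B n"
    then have "p \<in> B (Suc n)" unfolding B_def by (auto intro: le_SucI)
    then show "p x \<le> q (Suc n) x" by (rule q_ge(2))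
  qed (rule q_ge)
  moreover have "openin T U \<longleftrightarrow> U \<subseteq> E \<and> (\<forall>x\<in>U. \<exists>n. \<exists>r>0. {y \<in> E. q n (y - x) < r} \<subseteq> U)" for U
  proof (intro iffI conjI ballI)
    fix x assume U: "openin T U" and x: "x \<in> U"
    then have xE: "x \<in> E" using opn by blast
    obtain A' s where A': "finite A'" "A' \<subseteq> P" "0 < s" "{y \<in> E. \<forall>p\<in>A'. p (y - x) < s} \<subseteq> U"
      using bspec[OF conjunct2[OF iffD1[OF opn U]] x] by blast
    define N where "N = {y \<in> E. \<forall>p\<in>A'. p y < s}"
    have "openin T N"
      unfolding opn
    proof (intro conjI ballI)
      fix z assume z: "z \<in> N"
      have "{y \<in> E. \<forall>p\<in>A'. p (y - z) < s} \<subseteq> N"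
      proof
        fix y assume y: "y \<in> {y \<in> E. \<forall>p\<in>A'. p (y - z) < s}"
        have "p y < s" if "p \<in> A'" for p
          using that y z A'(2) P seminorm_le_max_diff[of p y z] unfolding N_def by fastforce
        then show "y \<in> N" using y by (simp add: N_def)
      qed
      then show "\<exists>A r. finite A \<and> A \<subseteq> P \<and> 0 < r \<and> {y \<in> E. \<forall>p\<in>A. p (y - z) < r} \<subseteq> N"
        using A' by blast
    qed (auto simp: N_def)
    moreover have "p 0 < s" if "p \<in> A'" for p
      using A'(2,3) that seminorm_zero[OF P, of p] by auto
    then have "0 \<in> N" unfolding N_def by simp
    ultimately obtain \<epsilon> where \<epsilon>: "0 < \<epsilon>" "M.mball 0 \<epsilon> \<subseteq> N"
      unfolding Td M.openin_mtopology by blast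
    obtain n where n: "1 / real (Suc n) < \<epsilon>"
      using \<epsilon>(1) nat_approx_posE by blast
    have "{y \<in> E. q n (y - x) < r n} \<subseteq> U"
    proof
      fix y assume y: "y \<in> {y \<in> E. q n (y - x) < r n}"
      then have "y - x \<in> {y \<in> E. \<forall>p\<in>A n. p y < r n}"
        using xE by (auto simp: diff_in_E q_less B_def)
      then have "y - x \<in> M.mball 0 (1 / real (Suc n))" using A(4) by blast
      then have "y - x \<in> N" using n \<epsilon>(2) M.mball_subset_concentric[of "1 / real (Suc n)" \<epsilon> 0] by fastforce
      then show "y \<in> U" using A'(4) y by (auto simp: N_def)
    qed
    then show "\<exists>n. \<exists>r>0. {y \<in> E. q n (y - x) < r} \<subseteq> U" using A(3) by blast
  next
    assume R: "U \<subseteq> E \<and> (\<forall>x\<in>U. \<exists>n. \<exists>r>0. {y \<in> E. q n (y - x) < r} \<subseteq> U)"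
    show "openin T U"
      unfolding opn
    proof (intro conjI ballI)
      fix x assume "x \<in> U"
      then obtain n r where r: "0 < r" "{y \<in> E. q n (y - x) < r} \<subseteq> U" using R by blast
      then have "{y \<in> E. \<forall>p\<in>B n. p (y - x) < r} \<subseteq> U" by (simp add: q_less)
      then show "\<exists>A r. finite A \<and> A \<subseteq> P \<and> 0 < r \<and> {y \<in> E. \<forall>p\<in>A. p (y - x) < r} \<subseteq> U"
        by (intro exI[of _ "B n"] exI[of _ r] conjI finB BP r)
    qed (use R in blast)
  qed (use topT openin_subset in blast)
  ultimately have "fundamental T q"
    unfolding fundamental_def by (intro conjI allI ballI topT semi)
  then show ?thesis by (rule that)
qed

context
  fixes T q assumes fund: "fundamental T q"
begin

lemma fundamental_topspace: "topspace T = E"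
  and fundamental_seminorm: "seminorm (q n)"
  and openin_fundamental: "openin T U \<longleftrightarrow>
    U \<subseteq> E \<and> (\<forall>x\<in>U. \<exists>n. \<exists>r>0. {y \<in> E. q n (y - x) < r} \<subseteq> U)"
  using fund unfolding fundamental_def by (fast, fast, simp)

lemma fundamental_mono:
  assumes "m \<le> n" "x \<in> E" shows "q m x \<le> q n x"
  using assms(1)
proof (induction n rule: dec_induct)
  case (step n)
  have "q n x \<le> q (Suc n) x" using fund assms(2) unfolding fundamental_def by blast
  then show ?case using step by linarith
qed simp

lemma fundamental_ball_open:
  assumes "x \<in> E" shows "openin T {y \<in> E. q n (y - x) < r}"
  unfolding openin_fundamental
proof (intro conjI ballI)
  fix z assume z: "z \<in> {y \<in> E. q n (y - x) < r}"
  then have "0 < r"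
    using assms seminorm_nonneg[OF fundamental_seminorm[of n], of "z - x"] by (auto simp: diff_in_E)
  moreover have "{y \<in> E. q n (y - z) < r} \<subseteq> {y \<in> E. q n (y - x) < r}"
  proof safe
    fix y assume "y \<in> E" "q n (y - z) < r"
    then show "q n (y - x) < r"
      using z assms seminorm_triangle[OF fundamental_seminorm[of n], of y z x] by auto
  qed
  ultimately show "\<exists>m. \<exists>r'>0. {y \<in> E. q m (y - z) < r'} \<subseteq> {y \<in> E. q n (y - x) < r}" by blast
qed auto

text \<open>The seminorms increase, so every \<open>q n\<close> lies below some \<open>q (s m)\<close>.\<close>
lemma fundamental_subsequence:
  assumes s: "strict_mono s" shows "fundamental T (\<lambda>n. q (s n))"
proof -
  have "q n x \<le> q (s n) x" if "x \<in> E" for n x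
    using fundamental_mono that s strict_mono_imp_increasing by blast
  then have "{y \<in> E. q (s n) (y - x) < r} \<subseteq> {y \<in> E. q n (y - x) < r}" if "x \<in> E" for n x r
    using \<open>\<And>x n. x \<in> E \<Longrightarrow> q n x \<le> q (s n) x\<close>[OF diff_in_E[OF _ that]]
    by (blast intro: le_less_trans)
  then have "(\<exists>n. \<exists>r>0. {y \<in> E. q n (y - x) < r} \<subseteq> U)
      \<longleftrightarrow> (\<exists>n. \<exists>r>0. {y \<in> E. q (s n) (y - x) < r} \<subseteq> U)" if "x \<in> E" for x U
    using that by (meson order_trans)
  then have opn: "openin T U \<longleftrightarrow>
      U \<subseteq> E \<and> (\<forall>x\<in>U. \<exists>n. \<exists>r>0. {y \<in> E. q (s n) (y - x) < r} \<subseteq> U)" for U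
    unfolding openin_fundamental by (meson subsetD)
  have mono: "q (s n) x \<le> q (s (Suc n)) x" if "x \<in> E" for n x
    using s that by (intro fundamental_mono) (simp_all add: strict_mono_less_eq)
  show ?thesis
    unfolding fundamental_def
    by (intro conjI allI ballI) (rule fundamental_topspace fundamental_seminorm mono opn, assumption?)+
qed

lemma limitin_fundamental:
  assumes f: "\<And>m. f m \<in> E"
  shows "limitin T f l sequentially \<longleftrightarrow> l \<in> E \<and> (\<forall>n. (\<lambda>m. q n (f m - l)) \<longlonglongrightarrow> 0)"
proof safe
  assume L: "limitin T f l sequentially"
  show l: "l \<in> E" using L fundamental_topspace by (simp add: limitin_def)
  fix n
  show "(\<lambda>m. q n (f m - l)) \<longlonglongrightarrow> 0"
  proof (rule order_tendstoI)
    fix a :: real assume "0 < a"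
    then have "l \<in> {y \<in> E. q n (y - l) < a}"
      using l seminorm_zero[OF fundamental_seminorm] by simp
    then have "\<forall>\<^sub>F m in sequentially. f m \<in> {y \<in> E. q n (y - l) < a}"
      by (rule limitinD[OF L fundamental_ball_open[OF l]])
    then show "\<forall>\<^sub>F m in sequentially. q n (f m - l) < a" by (rule eventually_mono) simp
  next
    fix a :: real assume "a < 0"
    then have "a < q n (f m - l)" for m
      using seminorm_nonneg[OF fundamental_seminorm[of n], of "f m - l"] f l by (simp add: diff_in_E)
    then show "\<forall>\<^sub>F m in sequentially. a < q n (f m - l)" by simp
  qed
next
  assume l: "l \<in> E" and L: "\<forall>n. (\<lambda>m. q n (f m - l)) \<longlonglongrightarrow> 0"
  show "limitin T f l sequentially"
    unfolding limitin_def
  proof (intro conjI allI impI)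
    fix U assume "openin T U \<and> l \<in> U"
    then obtain n r where r: "0 < r" "{y \<in> E. q n (y - l) < r} \<subseteq> U"
      unfolding openin_fundamental by blast
    have "\<forall>\<^sub>F m in sequentially. q n (f m - l) < r"
      using L r(1) by (intro order_tendstoD(2)[of _ 0]) auto
    then show "\<forall>\<^sub>F m in sequentially. f m \<in> U"
      by (rule eventually_mono) (use r f in auto)
  qed (simp add: l fundamental_topspace)
qed

text \<open>The image of the filter of cofinite sets of indices is a Cauchy filter.\<close>
lemma fundamental_Cauchy_convergent:
  assumes compl: "complete_tvs T" and f: "\<And>m. f m \<in> E"
    and Cauchy: "\<And>n \<epsilon>. 0 < \<epsilon> \<Longrightarrow> \<exists>N. \<forall>m\<ge>N. \<forall>m'\<ge>N. q n (f m - f m') < \<epsilon>"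
  obtains l where "l \<in> E" "\<And>n. (\<lambda>m. q n (f m - l)) \<longlonglongrightarrow> 0"
proof -
  define F where "F = filtermap f sequentially"
  have "cauchy_filter_in T F"
    unfolding cauchy_filter_in_def
  proof (intro conjI allI impI)
    show "F \<noteq> bot" by (simp add: F_def filtermap_bot_iff)
    show "F \<le> principal (topspace T)"
      unfolding F_def le_principal eventually_filtermap fundamental_topspace using f by simp
    fix U assume U: "openin T U \<and> 0 \<in> U"
    then obtain n r where r: "0 < r" "{y \<in> E. q n (y - 0) < r} \<subseteq> U"
      unfolding openin_fundamental by blast
    obtain N where N: "\<forall>m\<ge>N. \<forall>m'\<ge>N. q n (f m - f m') < r" using Cauchy r(1) by blast
    have "\<forall>\<^sub>F x in F. x \<in> f ` {N..}"
      unfolding F_def eventually_filtermap eventually_sequentially by auto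
    moreover have "\<forall>x\<in>f ` {N..}. \<forall>y\<in>f ` {N..}. x - y \<in> U"
      using N r(2) f by (auto simp: diff_in_E)
    ultimately show "\<exists>A. (\<forall>\<^sub>F x in F. x \<in> A) \<and> (\<forall>x\<in>A. \<forall>y\<in>A. x - y \<in> U)" by blast
  qed
  then obtain l where "limitin T (\<lambda>x. x) l F"
    using compl unfolding complete_tvs_def by blast
  then have "limitin T f l sequentially"
    unfolding limitin_def F_def eventually_filtermap by simp
  then show ?thesis using that limitin_fundamental f by blast
qed

lemma fundamental_subtopology:
  assumes D: "subspace D" "D \<subseteq> E"
  shows "nonarch_space.fundamental scl v D (subtopology T D) q"
proof -
  interpret D: nonarch_space scl v D
    by unfold_locales (use complete_field D in auto)
  have "openin (subtopology T D) U \<longleftrightarrow>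
    U \<subseteq> D \<and> (\<forall>x\<in>U. \<exists>n. \<exists>r>0. {y \<in> D. q n (y - x) < r} \<subseteq> U)" (is "?L \<longleftrightarrow> ?R") for U
  proof
    assume ?L
    then obtain V where V: "openin T V" "U = V \<inter> D" unfolding openin_subtopology by blast
    show ?R
    proof (intro conjI ballI)
      fix x assume "x \<in> U"
      then obtain n r where "0 < r" "{y \<in> E. q n (y - x) < r} \<subseteq> V"
        using V openin_fundamental by blast
      then show "\<exists>n. \<exists>r>0. {y \<in> D. q n (y - x) < r} \<subseteq> U" using V(2) D by blast
    qed (use V in blast)
  next
    assume R: ?R
    show ?L
    proof (subst openin_subopen, intro ballI)
      fix x assume x: "x \<in> U"
      then obtain n r where r: "0 < r" "{y \<in> D. q n (y - x) < r} \<subseteq> U" using R by blast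
      have xE: "x \<in> E" using R x D by blast
      have "openin (subtopology T D) ({y \<in> E. q n (y - x) < r} \<inter> D)"
        using fundamental_ball_open[OF xE] unfolding openin_subtopology by blast
      moreover have "x \<in> {y \<in> E. q n (y - x) < r} \<inter> D"
        using R x xE r seminorm_zero[OF fundamental_seminorm] by auto
      moreover have "{y \<in> E. q n (y - x) < r} \<inter> D \<subseteq> U" using r by blast
      ultimately show "\<exists>V. openin (subtopology T D) V \<and> x \<in> V \<and> V \<subseteq> U" by blast
    qed
  qed
  moreover have "D.seminorm (q n)" for n
    using fundamental_seminorm[of n] D unfolding nonarch_seminorm_on_def by blast
  moreover have "topspace (subtopology T D) = D"
    using D fundamental_topspace by auto
  moreover have "q n x \<le> q (Suc n) x" if "x \<in> D" for n x
    using D that fundamental_mono[of n "Suc n" x] by auto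
  ultimately show ?thesis unfolding D.fundamental_def by blast
qed

lemma Hausdorff_fundamental:
  assumes "Hausdorff_space T" "x \<in> E" "\<And>n. q n x = 0"
  shows "x = 0"
proof (rule ccontr)
  assume "x \<noteq> 0"
  then obtain U V where UV: "openin T U" "openin T V" "x \<in> V" "0 \<in> U" "disjnt U V"
    using assms(1,2) fundamental_topspace unfolding Hausdorff_space_def by (metis zero_in_E)
  obtain n r where "0 < r" "{y \<in> E. q n (y - 0) < r} \<subseteq> U"
    using UV(1,4) unfolding openin_fundamental by blast
  then have "x \<in> U" using assms by auto
  then show False using UV by (auto simp: disjnt_def)
qed

text \<open>The unit ball of a norm \<open>p\<close> defining the topology contains a ball of some \<open>q k\<close> and is contained,
  after scaling, in a ball of every \<open>q j\<close>; hence \<open>q j\<close> is dominated by \<open>p\<close>, and \<open>p\<close> by \<open>q k\<close>. Conversely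
  a dominating \<open>q k\<close> generates the topology, and it is a norm because the space is Hausdorff.\<close>
lemma normable_fundamental_iff:
  assumes "Hausdorff_space T"
  shows "normable v scl T \<longleftrightarrow> (\<exists>k. \<forall>j. dominated_on E (q j) (q k))"
proof
  assume "normable v scl T"
  then obtain p where p: "nonarch_norm_on v scl E p" and Tp: "T = seminorm_topology E {p}"
    unfolding normable_def fundamental_topspace by blast
  have sp: "seminorm p" using p unfolding nonarch_norm_on_def by blast
  note opn = openin_seminorm_topology_singleton[OF sp, folded Tp]
  have "openin T {y \<in> E. p (y - 0) < 1}"
    unfolding opn
  proof (intro conjI ballI)
    fix x assume x: "x \<in> {y \<in> E. p (y - 0) < 1}"
    have "{y \<in> E. p (y - x) < 1} \<subseteq> {y \<in> E. p (y - 0) < 1}"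
      using x seminorm_le_max_diff[OF sp, of _ x] by fastforce
    then show "\<exists>r>0. {y \<in> E. p (y - x) < r} \<subseteq> {y \<in> E. p (y - 0) < 1}"
      using zero_less_one by blast
  qed auto
  moreover have "0 \<in> {y \<in> E. p (y - 0) < 1}" by (simp add: seminorm_zero[OF sp])
  ultimately obtain k r where kr: "0 < r" "{y \<in> E. q k (y - 0) < r} \<subseteq> {y \<in> E. p (y - 0) < 1}"
    unfolding openin_fundamental by blast
  have pk: "dominated_on E p (q k)"
    by (rule dominated_on_of_balls[OF fundamental_seminorm sp kr(1), of 1]) (use kr in auto)
  have "dominated_on E (q j) (q k)" for j
  proof -
    have "0 \<in> {y \<in> E. q j (y - 0) < 1}" by (simp add: seminorm_zero[OF fundamental_seminorm])
    then obtain s where s: "0 < s" "{y \<in> E. p (y - 0) < s} \<subseteq> {y \<in> E. q j (y - 0) < 1}"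
      using fundamental_ball_open[OF zero_in_E, of j 1] unfolding opn by blast
    have "dominated_on E (q j) p"
      by (rule dominated_on_of_balls[OF sp fundamental_seminorm s(1), of 1]) (use s in auto)
    then obtain C where C: "0 < C" "\<And>x. x \<in> E \<Longrightarrow> q j x \<le> C * p x"
      using sp by (auto elim: dominated_onE)
    obtain C' where C': "\<And>x. x \<in> E \<Longrightarrow> p x \<le> C' * q k x"
      using pk unfolding dominated_on_def by blast
    have "q j x \<le> C * C' * q k x" if "x \<in> E" for x
    proof -
      have "C * p x \<le> C * (C' * q k x)" using C(1) C'[OF that] by simp
      then show ?thesis using C(2)[OF that] by (simp add: mult.assoc)
    qed
    then show ?thesis unfolding dominated_on_def by blast
  qed
  then show "\<exists>k. \<forall>j. dominated_on E (q j) (q k)" by blast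
next
  assume "\<exists>k. \<forall>j. dominated_on E (q j) (q k)"
  then obtain k where k: "\<And>j. dominated_on E (q j) (q k)" by blast
  have sk: "seminorm (q k)" by (rule fundamental_seminorm)
  have "nonarch_norm_on v scl E (q k)"
    unfolding nonarch_norm_on_def
  proof (intro conjI ballI impI)
    fix x assume x: "x \<in> E" "q k x = 0"
    have "q n x = 0" for n
    proof -
      obtain C where "q n x \<le> C * q k x" using k x unfolding dominated_on_def by blast
      then show ?thesis using x seminorm_nonneg[OF fundamental_seminorm[of n], of x] by simp
    qed
    then show "x = 0" using Hausdorff_fundamental assms x by blast
  qed (rule sk)
  moreover have "T = seminorm_topology E {q k}"
    unfolding topology_eq
  proof
    fix U
    have "(\<exists>n. \<exists>r>0. {y \<in> E. q n (y - x) < r} \<subseteq> U) \<longleftrightarrow> (\<exists>r>0. {y \<in> E. q k (y - x) < r} \<subseteq> U)"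
      if x: "x \<in> E" for x
    proof
      assume "\<exists>n. \<exists>r>0. {y \<in> E. q n (y - x) < r} \<subseteq> U"
      then obtain n r where r: "0 < r" "{y \<in> E. q n (y - x) < r} \<subseteq> U" by blast
      obtain C where C: "0 < C" "\<And>x. x \<in> E \<Longrightarrow> q n x \<le> C * q k x"
        using k[of n] sk by (auto elim: dominated_onE)
      have "{y \<in> E. q k (y - x) < r / C} \<subseteq> {y \<in> E. q n (y - x) < r}"
      proof safe
        fix y assume y: "y \<in> E" "q k (y - x) < r / C"
        then have "C * q k (y - x) < r" using C(1) by (simp add: pos_less_divide_eq mult.commute)
        then show "q n (y - x) < r" using C(2)[of "y - x"] x y by (simp add: diff_in_E)
      qed
      then show "\<exists>r>0. {y \<in> E. q k (y - x) < r} \<subseteq> U"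
        using r C(1) by (meson divide_pos_pos order_trans)
    qed blast
    then show "openin T U \<longleftrightarrow> openin (seminorm_topology E {q k}) U"
      unfolding openin_fundamental openin_seminorm_topology_singleton[OF sk] by (meson subsetD)
  qed
  ultimately show "normable v scl T"
    unfolding normable_def fundamental_topspace by blast
qed

end

section \<open>Almost orthogonal sequences are Schauder bases\<close>

lemma seminorm_sum_le:
  assumes p: "seminorm p" and "0 \<le> B" "\<And>k. k \<in> A \<Longrightarrow> f k \<in> E" "\<And>k. k \<in> A \<Longrightarrow> p (f k) \<le> B"
  shows "p (sum f A) \<le> B"
proof -
  have "sum f A \<in> E \<and> p (sum f A) \<le> B"
    using assms(3,4)
  proof (induction A rule: infinite_finite_induct)
    case (insert x A)
    then have "p (f x + sum f A) \<le> max (p (f x)) (p (sum f A))"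
      by (intro seminorm_add[OF p]) auto
    moreover have "p (f x) \<le> B" "p (sum f A) \<le> B" using insert by auto
    ultimately have "p (f x + sum f A) \<le> B" by linarith
    then show ?case using insert by (auto simp: add_in_E)
  qed (use assms(2) seminorm_zero[OF p] in auto)
  then show ?thesis ..
qed

text \<open>Almost orthogonality with factors \<open>c (Suc n) / c n\<close>. Writing the factors as such quotients turns
  their products into quotients \<open>c N / c n\<close>, which are at most \<open>2\<close> by the bounds on \<open>c\<close>. For \<open>n < i\<close> the
  vector \<open>e n\<close> may be far from orthogonal with respect to \<open>q i\<close>; its coefficient is controlled through
  the positivity of \<open>q (Suc n) (e n)\<close>.\<close>
context
  fixes T :: "'a topology" and q :: "nat \<Rightarrow> 'a \<Rightarrow> real" and e :: "nat \<Rightarrow> 'a" and c :: "nat \<Rightarrow> real"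
  assumes fund: "fundamental T q"
    and e_in_E: "\<And>n. e n \<in> E"
    and c_bounds: "\<And>n. 1 \<le> c n" "\<And>n. c n \<le> 2"
    and almost_orthogonal: "\<And>i n f a. i \<le> n \<Longrightarrow> f \<in> span (e ` {..<n}) \<Longrightarrow>
      c n * q i f \<le> c (Suc n) * q i (f + a \<odot> e n)"
    and e_nonzero: "\<And>n. 0 < q (Suc n) (e n)"
begin

definition partial_sum :: "(nat \<Rightarrow> 'k) \<Rightarrow> nat \<Rightarrow> 'a" where
  "partial_sum a n = (\<Sum>k<n. a k \<odot> e k)"

definition closed_span :: "'a set" where
  "closed_span = {x \<in> E. \<forall>i. \<forall>r>0. \<exists>y\<in>span (range e). q i (y - x) < r}"

lemma partial_sum_Suc: "partial_sum a (Suc n) = partial_sum a n + a n \<odot> e n"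
  and partial_sum_diff: "partial_sum (\<lambda>k. a k - b k) n = partial_sum a n - partial_sum b n"
  by (simp_all add: partial_sum_def scale_left_diff_distrib sum_subtractf)

lemma partial_sum_in_span: "partial_sum a n \<in> span (e ` {..<n})"
  unfolding partial_sum_def by (intro span_sum span_scale span_base) auto

lemma span_e_subset: "span (e ` A) \<subseteq> E"
  by (intro span_minimal subspace_E) (use e_in_E in auto)

lemma partial_sum_in_E: "partial_sum a n \<in> E"
  using partial_sum_in_span span_e_subset by blast

lemmas q_seminorm = fundamental_seminorm[OF fund]
lemmas q_nonneg = seminorm_nonneg[OF q_seminorm]
lemmas q_mono = fundamental_mono[OF fund]

text \<open>Multiplied by \<open>c n\<close>, the \<open>i\<close>-th seminorms of the partial sums increase from index \<open>i\<close> on.\<close>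
lemma partial_sum_bound_tail:
  assumes "i \<le> n" "n \<le> N"
  shows "q i (partial_sum a n) \<le> 2 * q i (partial_sum a N)"
proof -
  have "c n * q i (partial_sum a n) \<le> c N * q i (partial_sum a N)"
    using assms(2)
  proof (induction N rule: dec_induct)
    case (step m)
    have "c m * q i (partial_sum a m) \<le> c (Suc m) * q i (partial_sum a (Suc m))"
      unfolding partial_sum_Suc using assms(1) step(1)
      by (intro almost_orthogonal partial_sum_in_span) auto
    then show ?case using step.IH by linarith
  qed simp
  moreover have "q i (partial_sum a n) \<le> c n * q i (partial_sum a n)"
    using mult_right_mono[OF c_bounds(1)[of n] q_nonneg[OF partial_sum_in_E]] by simp
  moreover have "c N * q i (partial_sum a N) \<le> 2 * q i (partial_sum a N)"
    using mult_right_mono[OF c_bounds(2)[of N] q_nonneg[OF partial_sum_in_E]] by simp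
  ultimately show ?thesis by linarith
qed

lemma partial_sum_le_of_coefficients:
  assumes R: "0 \<le> R" and B: "\<And>k. k < n \<Longrightarrow> 0 \<le> B k" "\<And>k. k < n \<Longrightarrow> v (a k) \<le> B k * R"
  shows "q i (partial_sum a n) \<le> (\<Sum>k<n. B k * q i (e k)) * R"
  unfolding partial_sum_def
proof (rule seminorm_sum_le[OF q_seminorm])
  have nonneg: "0 \<le> B k * q i (e k)" if "k < n" for k
    using B(1)[OF that] q_nonneg e_in_E by simp
  show "0 \<le> (\<Sum>k<n. B k * q i (e k)) * R"
    by (rule mult_nonneg_nonneg[OF sum_nonneg R]) (simp add: nonneg)
  fix k assume "k \<in> {..<n}"
  then have k: "k < n" by simp
  have "v (a k) * q i (e k) \<le> (B k * R) * q i (e k)"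
    using B(2)[OF k] q_nonneg e_in_E by (intro mult_right_mono) auto
  also have "\<dots> = (B k * q i (e k)) * R" by simp
  also have "\<dots> \<le> (\<Sum>k<n. B k * q i (e k)) * R"
    using k nonneg R by (intro mult_right_mono member_le_sum) auto
  finally show "q i (a k \<odot> e k) \<le> (\<Sum>k<n. B k * q i (e k)) * R"
    using e_in_E by (simp add: seminorm_scale[OF q_seminorm])
qed (simp add: e_in_E scale_in_E)

text \<open>By recursion on \<open>n\<close>: the seminorm \<open>q (Suc n)\<close> of the partial sum of length \<open>n + 1\<close> is controlled by that
  of the whole sum, and that of its first \<open>n\<close> terms is controlled by the earlier coefficients. The
  remaining term is \<open>a n \<odot> e n\<close>, and \<open>q (Suc n) (e n)\<close> is positive.\<close>
lemma coefficient_bound_ex: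
  "\<exists>B\<ge>0. \<forall>a N. n < N \<longrightarrow> v (a n) \<le> B * q (Suc n) (partial_sum a N)"
proof (induction n rule: less_induct)
  case (less n)
  then have "\<forall>k. \<exists>B. k < n \<longrightarrow> 0 \<le> B \<and> (\<forall>a N. k < N \<longrightarrow> v (a k) \<le> B * q (Suc k) (partial_sum a N))"
    by blast
  from choice[OF this] obtain B where B: "\<And>k. k < n \<Longrightarrow> 0 \<le> B k"
    "\<And>k a N. k < n \<Longrightarrow> k < N \<Longrightarrow> v (a k) \<le> B k * q (Suc k) (partial_sum a N)"
    by blast
  define C where "C = 2 + (\<Sum>k<n. B k * q (Suc n) (e k))"
  have C: "2 \<le> C"
  proof -
    have "0 \<le> B k * q (Suc n) (e k)" if "k < n" for k
      using B(1)[OF that] q_nonneg e_in_E by simp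
    then have "0 \<le> (\<Sum>k<n. B k * q (Suc n) (e k))" by (intro sum_nonneg) simp
    then show ?thesis unfolding C_def by simp
  qed
  have "v (a n) \<le> C / q (Suc n) (e n) * q (Suc n) (partial_sum a N)" if N: "n < N" for a N
  proof -
    let ?Q = "q (Suc n) (partial_sum a N)"
    have Q: "0 \<le> ?Q" by (intro q_nonneg partial_sum_in_E)
    have "v (a k) \<le> B k * ?Q" if k: "k < n" for k
    proof -
      have "v (a k) \<le> B k * q (Suc k) (partial_sum a N)" using B(2) k N by simp
      also have "\<dots> \<le> B k * ?Q"
        using k B(1) by (intro mult_left_mono q_mono partial_sum_in_E) auto
      finally show ?thesis .
    qed
    then have "q (Suc n) (partial_sum a n) \<le> (\<Sum>k<n. B k * q (Suc n) (e k)) * ?Q"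
      using Q B(1) by (intro partial_sum_le_of_coefficients)
    also have "\<dots> \<le> C * ?Q" using Q by (intro mult_right_mono) (auto simp: C_def)
    finally have "q (Suc n) (partial_sum a n) \<le> C * ?Q" .
    moreover have "q (Suc n) (partial_sum a (Suc n)) \<le> 2 * ?Q"
      using N by (intro partial_sum_bound_tail) auto
    moreover have "2 * ?Q \<le> C * ?Q" using C Q by (rule mult_right_mono)
    moreover have "q (Suc n) (a n \<odot> e n)
        \<le> max (q (Suc n) (partial_sum a (Suc n))) (q (Suc n) (partial_sum a n))"
      using seminorm_diff[OF q_seminorm partial_sum_in_E partial_sum_in_E, of "Suc n" a "Suc n" a n]
      by (simp add: partial_sum_Suc)
    ultimately have "v (a n) * q (Suc n) (e n) \<le> C * ?Q"
      using e_in_E by (simp add: seminorm_scale[OF q_seminorm])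
    then show ?thesis using e_nonzero[of n] by (simp add: field_simps)
  qed
  moreover have "0 \<le> C / q (Suc n) (e n)" using C e_nonzero[of n] by simp
  ultimately show ?case by blast
qed

lemma obtain_coefficient_bound:
  obtains B where "\<And>n. 0 \<le> B n"
    "\<And>n a N. n < N \<Longrightarrow> v (a n) \<le> B n * q (Suc n) (partial_sum a N)"
proof -
  have "\<forall>n. \<exists>B\<ge>0. \<forall>a N. n < N \<longrightarrow> v (a n) \<le> B * q (Suc n) (partial_sum a N)"
    by (intro allI coefficient_bound_ex)
  from choice[OF this] obtain B
    where "\<forall>n. 0 \<le> B n \<and> (\<forall>a N. n < N \<longrightarrow> v (a n) \<le> B n * q (Suc n) (partial_sum a N))"
    by (elim exE)
  then show ?thesis by (intro that[of B]) auto
qed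

text \<open>The partial sum projections are equicontinuous: those of length at least \<open>i\<close> are bounded for \<open>q i\<close> by
  almost orthogonality, the finitely many shorter ones by the bounds on the coefficients.\<close>
lemma partial_sum_bound:
  "\<exists>C>0. \<forall>a n N. n \<le> N \<longrightarrow> q i (partial_sum a n) \<le> C * q i (partial_sum a N)"
proof -
  obtain B where B: "\<And>n. 0 \<le> B n"
    "\<And>n a N. n < N \<Longrightarrow> v (a n) \<le> B n * q (Suc n) (partial_sum a N)"
    by (rule obtain_coefficient_bound) blast
  define C where "C = 2 + (\<Sum>k<i. B k * q i (e k))"
  have term_nonneg: "0 \<le> B k * q i (e k)" for k
    using B(1) q_nonneg e_in_E by simp
  then have C: "2 \<le> C" unfolding C_def by (simp add: sum_nonneg)
  have "q i (partial_sum a n) \<le> C * q i (partial_sum a N)" if N: "n \<le> N" for a n N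
  proof -
    let ?Q = "q i (partial_sum a N)"
    have Q: "0 \<le> ?Q" by (intro q_nonneg partial_sum_in_E)
    show ?thesis
    proof (cases "i \<le> n")
      case True
      then have "q i (partial_sum a n) \<le> 2 * ?Q" using N by (rule partial_sum_bound_tail)
      also have "\<dots> \<le> C * ?Q" using C Q by (rule mult_right_mono)
      finally show ?thesis .
    next
      case False
      have "v (a k) \<le> B k * ?Q" if k: "k < n" for k
      proof -
        have "v (a k) \<le> B k * q (Suc k) (partial_sum a N)" using B(2) k N by simp
        also have "\<dots> \<le> B k * ?Q"
          using k False B(1) by (intro mult_left_mono q_mono partial_sum_in_E) auto
        finally show ?thesis .
      qed
      then have "q i (partial_sum a n) \<le> (\<Sum>k<n. B k * q i (e k)) * ?Q"
        using Q B(1) by (intro partial_sum_le_of_coefficients)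
      also have "(\<Sum>k<n. B k * q i (e k)) \<le> (\<Sum>k<i. B k * q i (e k))"
        using False term_nonneg by (intro sum_mono2) auto
      then have "(\<Sum>k<n. B k * q i (e k)) * ?Q \<le> C * ?Q"
        using Q by (intro mult_right_mono) (auto simp: C_def)
      finally show ?thesis .
    qed
  qed
  then show ?thesis using C by (intro exI[of _ C]) auto
qed

lemma span_range_e:
  assumes "y \<in> span (range e)"
  obtains a N where "y = partial_sum a N" "\<And>n. N \<le> n \<Longrightarrow> a n = 0"
proof -
  have "\<exists>a N. y = partial_sum a N \<and> (\<forall>n\<ge>N. a n = 0)"
    using assms
  proof (induction rule: span_induct_alt)
    case base
    have "0 = partial_sum (\<lambda>_. 0) 0" by (simp add: partial_sum_def)
    then show ?case by blast
  next
    case (step b x y)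
    then obtain m a N where x: "x = e m" and y: "y = partial_sum a N" "\<forall>n\<ge>N. a n = 0" by blast
    let ?a = "\<lambda>n. (if n = m then b else 0) + a n" and ?N = "max (Suc m) N"
    have "partial_sum a ?N = partial_sum a N"
      unfolding partial_sum_def by (rule sum.mono_neutral_right) (use y(2) in auto)
    moreover have "partial_sum (\<lambda>n. if n = m then b else 0) ?N = b \<odot> e m"
    proof -
      have "partial_sum (\<lambda>n. if n = m then b else 0) ?N = (\<Sum>k<?N. if k = m then b \<odot> e m else 0)"
        unfolding partial_sum_def by (rule sum.cong) auto
      also have "\<dots> = b \<odot> e m" by (subst sum.delta) auto
      finally show ?thesis .
    qed
    ultimately have "b \<odot> x + y = partial_sum ?a ?N"
      unfolding x y(1) by (simp add: partial_sum_def scale_left_distrib sum.distrib)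
    moreover have "\<forall>n\<ge>?N. ?a n = 0" using y(2) by auto
    ultimately show ?case by blast
  qed
  then show ?thesis using that by blast
qed

lemma partial_sum_eventually_constant:
  assumes "\<And>n. N \<le> n \<Longrightarrow> a n = 0" "N \<le> M"
  shows "partial_sum a M = partial_sum a N"
  unfolding partial_sum_def by (rule sum.mono_neutral_right) (use assms in auto)

lemma span_range_subset_closed_span: "span (range e) \<subseteq> closed_span"
proof
  fix x assume x: "x \<in> span (range e)"
  moreover have "x \<in> E" using x span_e_subset by blast
  ultimately show "x \<in> closed_span"
    unfolding closed_span_def using bexI[OF _ x] seminorm_zero[OF q_seminorm] by simp
qed

lemma partial_sum_in_closed_span: "partial_sum a n \<in> closed_span"
proof -
  have "partial_sum a n \<in> span (range e)"
    using partial_sum_in_span span_mono[of "e ` {..<n}" "range e"] by blast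
  then show ?thesis using span_range_subset_closed_span by blast
qed

lemma closed_span_subset: "closed_span \<subseteq> E"
  unfolding closed_span_def by blast

lemma subspace_closed_span: "subspace closed_span"
  unfolding subspace_def
proof (intro conjI ballI allI)
  show "0 \<in> closed_span" using span_range_subset_closed_span span_zero by blast
next
  fix x y assume x: "x \<in> closed_span" and y: "y \<in> closed_span"
  then have E: "x \<in> E" "y \<in> E" using closed_span_subset by auto
  have "\<exists>z\<in>span (range e). q i (z - (x + y)) < r" if "0 < r" for i r
  proof -
    obtain x' where x': "x' \<in> span (range e)" "q i (x' - x) < r"
      using x \<open>0 < r\<close> unfolding closed_span_def by blast
    obtain y' where y': "y' \<in> span (range e)" "q i (y' - y) < r"
      using y \<open>0 < r\<close> unfolding closed_span_def by blast
    have "x' \<in> E" "y' \<in> E" using x' y' span_e_subset by blast+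
    then have "q i ((x' - x) + (y' - y)) \<le> max (q i (x' - x)) (q i (y' - y))"
      using E by (intro seminorm_add[OF q_seminorm] diff_in_E)
    then have "q i ((x' + y') - (x + y)) < r" using x' y' by (simp add: algebra_simps)
    then show ?thesis using x' y' span_add by blast
  qed
  then show "x + y \<in> closed_span" using E add_in_E unfolding closed_span_def by blast
next
  fix b x assume x: "x \<in> closed_span"
  then have E: "x \<in> E" using closed_span_subset by auto
  have "\<exists>z\<in>span (range e). q i (z - b \<odot> x) < r" if "0 < r" for i r
  proof -
    have "0 < r / (v b + 1)" using that valuation_nonneg[of b] by (simp add: add_nonneg_pos)
    then obtain x' where x': "x' \<in> span (range e)" "q i (x' - x) < r / (v b + 1)"
      using x unfolding closed_span_def by blast
    have xE: "x' - x \<in> E" using x' span_e_subset E by (blast intro: diff_in_E)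
    have "q i (b \<odot> x' - b \<odot> x) = v b * q i (x' - x)"
      using seminorm_scale[OF q_seminorm xE, of i b] by (simp add: scale_right_diff_distrib)
    also have "\<dots> \<le> (v b + 1) * q i (x' - x)"
      using q_nonneg[OF xE] by (intro mult_right_mono) auto
    also have "\<dots> < r"
      using x'(2) valuation_nonneg[of b] by (simp add: pos_less_divide_eq add_nonneg_pos mult.commute)
    finally show ?thesis using x' span_scale by blast
  qed
  then show "b \<odot> x \<in> closed_span" using E scale_in_E unfolding closed_span_def by blast
qed

lemma closedin_closed_span: "closedin T closed_span"
proof -
  have "openin T (E - closed_span)"
    unfolding openin_fundamental[OF fund]
  proof (intro conjI ballI)
    fix x assume x: "x \<in> E - closed_span"
    then obtain i r where r: "0 < r" "\<And>y. y \<in> span (range e) \<Longrightarrow> r \<le> q i (y - x)"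
      unfolding closed_span_def by (auto simp: not_less)
    have "{y \<in> E. q i (y - x) < r} \<subseteq> E - closed_span"
    proof safe
      fix z assume z: "z \<in> E" "q i (z - x) < r" "z \<in> closed_span"
      then obtain y where y: "y \<in> span (range e)" "q i (y - z) < r"
        using r(1) unfolding closed_span_def by blast
      then have "y \<in> E" using span_e_subset by blast
      then have "q i (y - x) < r"
        using seminorm_triangle[OF q_seminorm, of y z x i] y z x by auto
      then show False using r(2)[OF y(1)] by linarith
    qed
    then show "\<exists>n. \<exists>r>0. {y \<in> E. q n (y - x) < r} \<subseteq> E - closed_span" using r(1) by blast
  qed auto
  then show ?thesis
    using closed_span_subset unfolding closedin_def fundamental_topspace[OF fund] by blast
qed

text \<open>Approximate \<open>x\<close> by finite combinations \<open>y m\<close>. Their coefficients are Cauchy because the coefficient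
  functionals are bounded, and the scalars are complete; the limits are the coefficients of \<open>x\<close>. The
  expansion converges because the partial sum projections are equicontinuous and, for large \<open>n\<close>, the
  \<open>n\<close>-th one fixes \<open>y m\<close>.\<close>
lemma closed_span_expansion:
  assumes x: "x \<in> closed_span"
  obtains a where "\<And>i. (\<lambda>n. q i (partial_sum a n - x)) \<longlonglongrightarrow> 0"
proof -
  have xE: "x \<in> E" using x closed_span_subset by blast
  obtain B where B: "\<And>n. 0 \<le> B n"
    "\<And>n a N. n < N \<Longrightarrow> v (a n) \<le> B n * q (Suc n) (partial_sum a N)"
    by (rule obtain_coefficient_bound) blast
  have "\<exists>b N. (\<forall>n\<ge>N. b n = 0) \<and> q m (partial_sum b N - x) < 1 / real (Suc m)" for m
  proof -
    have "0 < 1 / real (Suc m)" by simp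
    then obtain y where y: "y \<in> span (range e)" "q m (y - x) < 1 / real (Suc m)"
      using x unfolding closed_span_def by blast
    then show ?thesis using span_range_e[OF y(1)] by metis
  qed
  then obtain b N where bN: "\<And>m n. N m \<le> n \<Longrightarrow> b m n = 0"
    "\<And>m. q m (partial_sum (b m) (N m) - x) < 1 / real (Suc m)"
    by metis
  define y where "y m = partial_sum (b m) (N m)" for m
  have yE: "y m \<in> E" for m unfolding y_def by (rule partial_sum_in_E)
  have y_const: "partial_sum (b m) M = y m" if "N m \<le> M" for m M
    unfolding y_def using partial_sum_eventually_constant bN(1) that by blast
  have y_close: "\<exists>m0. \<forall>m\<ge>m0. q i (y m - x) < \<epsilon>" if \<epsilon>: "0 < \<epsilon>" for i \<epsilon>
  proof -
    obtain k where k: "1 / real (Suc k) < \<epsilon>" using nat_approx_posE[OF \<epsilon>] .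
    have "q i (y m - x) < \<epsilon>" if m: "max i k \<le> m" for m
    proof -
      have "q i (y m - x) \<le> q m (y m - x)" using m yE xE by (intro q_mono diff_in_E) auto
      also have "\<dots> < 1 / real (Suc m)" unfolding y_def by (rule bN(2))
      also have "\<dots> \<le> 1 / real (Suc k)" using m by (intro divide_left_mono) auto
      finally show ?thesis using k by linarith
    qed
    then show ?thesis by blast
  qed
  have y_Cauchy: "\<exists>m0. \<forall>m\<ge>m0. \<forall>l\<ge>m0. q i (y m - y l) < \<epsilon>" if \<epsilon>: "0 < \<epsilon>" for i \<epsilon>
  proof -
    obtain m0 where m0: "\<forall>m\<ge>m0. q i (y m - x) < \<epsilon>" using y_close[OF \<epsilon>] by blast
    have "q i (y m - y l) < \<epsilon>" if "m \<ge> m0" "l \<ge> m0" for m l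
    proof -
      have "q i (y m - y l) \<le> max (q i (y m - x)) (q i (x - y l))"
        by (rule seminorm_triangle[OF q_seminorm yE xE yE])
      moreover have "q i (x - y l) = q i (y l - x)"
        by (rule seminorm_minus_commute[OF q_seminorm xE yE])
      moreover have "q i (y m - x) < \<epsilon>" "q i (y l - x) < \<epsilon>" using m0 that by auto
      ultimately show ?thesis by linarith
    qed
    then show ?thesis by blast
  qed
  have coeff_diff: "v (b m n - b l n) \<le> B n * q (Suc n) (y m - y l)" for m l n
  proof -
    let ?M = "max (Suc n) (max (N m) (N l))"
    have "v (b m n - b l n) \<le> B n * q (Suc n) (partial_sum (\<lambda>k. b m k - b l k) ?M)"
      by (rule B(2)[of n ?M "\<lambda>k. b m k - b l k"]) simp
    then show ?thesis by (simp add: partial_sum_diff y_const)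
  qed
  have "\<exists>l. (\<lambda>m. v (b m n - l)) \<longlonglongrightarrow> 0" for n
  proof -
    have "\<exists>m0. \<forall>m\<ge>m0. \<forall>l\<ge>m0. v (b m n - b l n) < \<epsilon>" if \<epsilon>: "0 < \<epsilon>" for \<epsilon>
    proof -
      have "0 < \<epsilon> / (B n + 1)" using \<epsilon> B(1)[of n] by simp
      then obtain m0 where m0: "\<forall>m\<ge>m0. \<forall>l\<ge>m0. q (Suc n) (y m - y l) < \<epsilon> / (B n + 1)"
        using y_Cauchy by blast
      have "v (b m n - b l n) < \<epsilon>" if "m \<ge> m0" "l \<ge> m0" for m l
      proof -
        have "v (b m n - b l n) \<le> B n * q (Suc n) (y m - y l)" by (rule coeff_diff)
        also have "\<dots> \<le> (B n + 1) * q (Suc n) (y m - y l)"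
          using q_nonneg[OF diff_in_E[OF yE yE]] by (intro mult_right_mono) auto
        also have "\<dots> < \<epsilon>"
          using m0 that B(1)[of n] by (simp add: pos_less_divide_eq mult.commute)
        finally show ?thesis .
      qed
      then show ?thesis by blast
    qed
    then show ?thesis using field_Cauchy_convergent[of "\<lambda>m. b m n"] by blast
  qed
  then obtain a where a: "\<And>n. (\<lambda>m. v (b m n - a n)) \<longlonglongrightarrow> 0" by metis
  \<comment> \<open>For a fixed length, convergence of the coefficients gives convergence of the partial sums.\<close>
  have sums_tend: "(\<lambda>l. q i (partial_sum (b l) n - partial_sum a n)) \<longlonglongrightarrow> 0" for i n
  proof (rule tendsto_sandwich[OF _ _ tendsto_const])
    show "(\<lambda>l. \<Sum>k<n. v (b l k - a k) * q i (e k)) \<longlonglongrightarrow> 0"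
      by (rule tendsto_null_sum) (rule tendsto_mult_left_zero[OF a])
    show "\<forall>\<^sub>F l in sequentially. 0 \<le> q i (partial_sum (b l) n - partial_sum a n)"
      by (simp add: q_nonneg diff_in_E partial_sum_in_E)
    have "q i (partial_sum (b l) n - partial_sum a n) \<le> (\<Sum>k<n. v (b l k - a k) * q i (e k))" for l
      unfolding partial_sum_diff[symmetric] unfolding partial_sum_def
    proof (rule seminorm_sum_le[OF q_seminorm])
      fix k assume "k \<in> {..<n}"
      then have "v (b l k - a k) * q i (e k) \<le> (\<Sum>k<n. v (b l k - a k) * q i (e k))"
        using q_nonneg e_in_E by (intro member_le_sum) auto
      then show "q i ((b l k - a k) \<odot> e k) \<le> (\<Sum>k<n. v (b l k - a k) * q i (e k))"
        by (simp add: seminorm_scale[OF q_seminorm] e_in_E)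
    qed (auto simp: e_in_E scale_in_E q_nonneg intro!: sum_nonneg)
    then show "\<forall>\<^sub>F l in sequentially. q i (partial_sum (b l) n - partial_sum a n)
        \<le> (\<Sum>k<n. v (b l k - a k) * q i (e k))" by simp
  qed
  have "(\<lambda>n. q i (partial_sum a n - x)) \<longlonglongrightarrow> 0" for i
    unfolding LIMSEQ_iff
  proof (intro allI impI)
    fix \<epsilon> :: real assume \<epsilon>: "0 < \<epsilon>"
    obtain C where C: "0 < C" "\<And>a n N. n \<le> N \<Longrightarrow> q i (partial_sum a n) \<le> C * q i (partial_sum a N)"
      using partial_sum_bound by blast
    obtain m1 where m1: "\<forall>m\<ge>m1. q i (y m - x) < \<epsilon>" using y_close[OF \<epsilon>] by blast
    have "0 < \<epsilon> / C" using \<epsilon> C by simp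
    then obtain m2 where m2: "\<forall>m\<ge>m2. \<forall>l\<ge>m2. q i (y m - y l) < \<epsilon> / C" using y_Cauchy by blast
    define m where "m = max m1 m2"
    have "norm (q i (partial_sum a n - x) - 0) < \<epsilon>" if n: "N m \<le> n" for n
    proof -
      have "\<forall>\<^sub>F l in sequentially. q i (partial_sum (b l) n - partial_sum a n) < \<epsilon>"
        using order_tendstoD(2)[OF sums_tend \<epsilon>] .
      then obtain l0 where "\<forall>l\<ge>l0. q i (partial_sum (b l) n - partial_sum a n) < \<epsilon>"
        unfolding eventually_sequentially by blast
      then obtain l where l: "l \<ge> m2" "q i (partial_sum (b l) n - partial_sum a n) < \<epsilon>"
        using max.cobounded1 max.cobounded2 by metis
      let ?M = "max n (N l)"
      have "q i (y m - partial_sum (b l) n) = q i (partial_sum (\<lambda>k. b m k - b l k) n)"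
        using y_const[OF n] by (simp add: partial_sum_diff)
      also have "\<dots> \<le> C * q i (partial_sum (\<lambda>k. b m k - b l k) ?M)" by (rule C(2)) simp
      also have "\<dots> = C * q i (y m - y l)"
        using n by (simp add: partial_sum_diff y_const)
      also have "\<dots> < \<epsilon>"
        using m2 l(1) C(1) by (simp add: m_def pos_less_divide_eq mult.commute)
      finally have 1: "q i (y m - partial_sum (b l) n) < \<epsilon>" .
      have 2: "q i (y m - x) < \<epsilon>" using m1 by (simp add: m_def)
      have "q i (y m - partial_sum a n) \<le>
          max (q i (y m - partial_sum (b l) n)) (q i (partial_sum (b l) n - partial_sum a n))"
        by (intro seminorm_triangle[OF q_seminorm] yE partial_sum_in_E)
      moreover have "q i (partial_sum a n - x) \<le> max (q i (partial_sum a n - y m)) (q i (y m - x))"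
        by (intro seminorm_triangle[OF q_seminorm] yE partial_sum_in_E xE)
      moreover have "q i (partial_sum a n - y m) = q i (y m - partial_sum a n)"
        by (intro seminorm_minus_commute[OF q_seminorm] yE partial_sum_in_E)
      moreover have "0 \<le> q i (partial_sum a n - x)"
        by (intro q_nonneg diff_in_E partial_sum_in_E xE)
      ultimately show ?thesis using 1 2 l(2) by simp
    qed
    then show "\<exists>no. \<forall>n\<ge>no. norm (q i (partial_sum a n - x) - 0) < \<epsilon>" by blast
  qed
  then show ?thesis by (rule that)
qed

text \<open>One estimate serves twice: with \<open>x = y\<close> it gives uniqueness of the expansion, and in general
  continuity of the coefficient functionals.\<close>
lemma coefficients_continuous:
  assumes "x \<in> E" "y \<in> E"
    and a: "\<And>i. (\<lambda>n. q i (partial_sum a n - x)) \<longlonglongrightarrow> 0"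
    and b: "\<And>i. (\<lambda>n. q i (partial_sum b n - y)) \<longlonglongrightarrow> 0"
    and B: "\<And>n a N. n < N \<Longrightarrow> v (a n) \<le> B n * q (Suc n) (partial_sum a N)" "\<And>n. 0 \<le> B n"
  shows "v (a n - b n) \<le> B n * q (Suc n) (x - y)"
proof (rule field_le_epsilon)
  fix \<epsilon> :: real assume \<epsilon>: "0 < \<epsilon>"
  define \<delta> where "\<delta> = \<epsilon> / (B n + 1)"
  have \<delta>: "0 < \<delta>" using \<epsilon> B(2)[of n] by (simp add: \<delta>_def)
  have "\<forall>\<^sub>F N in sequentially. q (Suc n) (partial_sum a N - x) < \<delta> \<and>
      q (Suc n) (partial_sum b N - y) < \<delta> \<and> n < N"
    using order_tendstoD(2)[OF a \<delta>] order_tendstoD(2)[OF b \<delta>] eventually_gt_at_top[of n]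
    by eventually_elim auto
  from eventually_happens'[OF sequentially_bot this]
  obtain N where N: "q (Suc n) (partial_sum a N - x) < \<delta>"
      "q (Suc n) (partial_sum b N - y) < \<delta>" "n < N"
    by (elim exE conjE)
  let ?d = "partial_sum a N - partial_sum b N" and ?q = "q (Suc n)"
  have E: "?d \<in> E" "x - y \<in> E" by (intro diff_in_E partial_sum_in_E assms(1,2))+
  have "?q ((partial_sum a N - x) - (partial_sum b N - y)) \<le> max (?q (partial_sum a N - x)) (?q (partial_sum b N - y))"
    by (intro seminorm_diff[OF q_seminorm] diff_in_E partial_sum_in_E assms(1,2))
  then have "?q (?d - (x - y)) < \<delta>" using N by (simp add: algebra_simps)
  moreover have "?q ?d \<le> max (?q (?d - (x - y))) (?q (x - y))"
    by (rule seminorm_le_max_diff[OF q_seminorm E])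
  ultimately have "?q ?d \<le> ?q (x - y) + \<delta>" using q_nonneg[OF E(2), of "Suc n"] \<delta> by linarith
  then have "B n * ?q ?d \<le> B n * (?q (x - y) + \<delta>)" using B(2) by (rule mult_left_mono)
  moreover have "v (a n - b n) \<le> B n * ?q ?d"
    using B(1)[of n N "\<lambda>k. a k - b k"] N(3) by (simp add: partial_sum_diff)
  moreover have "B n * \<delta> \<le> \<epsilon>"
    using \<epsilon> B(2)[of n] by (simp add: \<delta>_def field_simps)
  ultimately show "v (a n - b n) \<le> B n * ?q (x - y) + \<epsilon>" by (simp add: algebra_simps)
qed

lemma series_represents_iff:
  assumes "x \<in> closed_span"
  shows "series_represents scl (subtopology T closed_span) e a x
    \<longleftrightarrow> (\<forall>i. (\<lambda>n. q i (partial_sum a n - x)) \<longlonglongrightarrow> 0)"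
proof -
  interpret D: nonarch_space scl v closed_span
    by unfold_locales (rule complete_field subspace_closed_span)+
  have "D.fundamental (subtopology T closed_span) q"
    by (rule fundamental_subtopology[OF fund subspace_closed_span closed_span_subset])
  from D.limitin_fundamental[OF this, of "partial_sum a" x]
  have "limitin (subtopology T closed_span) (partial_sum a) x sequentially
      \<longleftrightarrow> (\<forall>i. (\<lambda>n. q i (partial_sum a n - x)) \<longlonglongrightarrow> 0)"
    using assms partial_sum_in_closed_span by simp
  moreover have "partial_sum a = (\<lambda>n. \<Sum>k<n. a k \<odot> e k)"
    by (simp add: partial_sum_def fun_eq_iff)
  ultimately show ?thesis unfolding series_represents_def by simp
qed

lemma schauder_basis_closed_span: "schauder_basis v scl (subtopology T closed_span) e"
proof -
  let ?D = "subtopology T closed_span"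
  interpret D: nonarch_space scl v closed_span
    by unfold_locales (rule complete_field subspace_closed_span)+
  have fundD: "D.fundamental ?D q"
    by (rule fundamental_subtopology[OF fund subspace_closed_span closed_span_subset])
  have topD: "topspace ?D = closed_span" by (rule D.fundamental_topspace[OF fundD])
  obtain B where B: "\<And>n. 0 \<le> B n"
    "\<And>n a N. n < N \<Longrightarrow> v (a n) \<le> B n * q (Suc n) (partial_sum a N)"
    by (rule obtain_coefficient_bound) blast
  have close: "v (a n - b n) \<le> B n * q (Suc n) (x - y)"
    if "series_represents scl ?D e a x" "series_represents scl ?D e b y"
      "x \<in> closed_span" "y \<in> closed_span" for a b x y n
    using that series_represents_iff closed_span_subset
    by (intro coefficients_continuous B) auto
  have ex1: "\<exists>!a. series_represents scl ?D e a x" if x: "x \<in> closed_span" for x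
  proof (rule ex_ex1I)
    show "\<exists>a. series_represents scl ?D e a x"
      by (rule closed_span_expansion[OF x]) (auto simp: series_represents_iff[OF x])
  next
    fix a b assume "series_represents scl ?D e a x" "series_represents scl ?D e b x"
    then have "v (a n - b n) \<le> B n * q (Suc n) (x - x)" for n using close x by blast
    then have "v (a n - b n) \<le> 0" for n by (simp add: seminorm_zero[OF q_seminorm])
    then show "a = b" using valuation_nonneg valuation_eq_0_iff
      by (metis antisym eq_iff_diff_eq_0 ext)
  qed
  have rep: "series_represents scl ?D e (\<lambda>n. coefficient_functional scl ?D e n x) x"
    if "x \<in> closed_span" for x
    unfolding coefficient_functional_def using theI'[OF ex1[OF that]] by simp
  have "continuous_map ?D (valuation_topology v) (coefficient_functional scl ?D e n)" for n
  proof (rule continuous_map_valuation)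
    fix x and \<epsilon> :: real assume "x \<in> topspace ?D" and \<epsilon>: "0 < \<epsilon>"
    then have x: "x \<in> closed_span" by (simp only: topD)
    let ?U = "{y \<in> closed_span. q (Suc n) (y - x) < \<epsilon> / (B n + 1)}"
    have pos: "0 < \<epsilon> / (B n + 1)" using \<epsilon> B(1)[of n] by simp
    have "openin ?D ?U" by (rule D.fundamental_ball_open[OF fundD x])
    moreover have "x \<in> ?U" using x pos by (simp add: seminorm_zero[OF q_seminorm])
    moreover have "v (coefficient_functional scl ?D e n y - coefficient_functional scl ?D e n x) < \<epsilon>"
      if y: "y \<in> ?U" for y
    proof -
      have "v (coefficient_functional scl ?D e n y - coefficient_functional scl ?D e n x)
          \<le> B n * q (Suc n) (y - x)"
        using close[OF rep rep] x y by blast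
      also have "\<dots> \<le> (B n + 1) * q (Suc n) (y - x)"
        using x y closed_span_subset by (intro mult_right_mono q_nonneg diff_in_E) auto
      also have "\<dots> < \<epsilon>"
        using y B(1)[of n] by (simp add: pos_less_divide_eq mult.commute)
      finally show ?thesis .
    qed
    ultimately show "\<exists>U. openin ?D U \<and> x \<in> U \<and> (\<forall>y\<in>U.
        v (coefficient_functional scl ?D e n y - coefficient_functional scl ?D e n x) < \<epsilon>)"
      by blast
  qed
  moreover have "range e \<subseteq> closed_span"
    using span_range_subset_closed_span span_superset by blast
  ultimately show ?thesis
    unfolding schauder_basis_def topD using ex1 by blast
qed

end

text \<open>The construction of the subspace is hereby reduced to that of a sequence along which no seminorm
  dominates all others.\<close>
lemma ex_nonnormable_subspace_with_basis:
  assumes fund: "fundamental T q" and Haus: "Hausdorff_space T"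
    and e: "\<And>n. e n \<in> E" and c: "\<And>n. 1 \<le> c n" "\<And>n. c n \<le> 2"
    and orth: "\<And>i n f a. i \<le> n \<Longrightarrow> f \<in> span (e ` {..<n}) \<Longrightarrow>
      c n * q i f \<le> c (Suc n) * q i (f + a \<odot> e n)"
    and nz: "\<And>n. 0 < q (Suc n) (e n)"
    and unbounded: "\<And>k. \<exists>j. \<forall>C. \<exists>n. C * q k (e n) < q j (e n)"
  shows "\<exists>D e. subspace D \<and> closedin T D \<and> schauder_basis v scl (subtopology T D) e \<and>
    \<not> normable v scl (subtopology T D)"
proof -
  let ?D = "closed_span q e"
  have sub: "subspace ?D" and sub2: "?D \<subseteq> E"
    by (rule subspace_closed_span[OF fund e c orth nz] closed_span_subset[OF fund e c orth nz]; assumption)+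
  have clo: "closedin T ?D" and bas: "schauder_basis v scl (subtopology T ?D) e"
    and ran: "span (range e) \<subseteq> ?D"
    by (rule closedin_closed_span[OF fund e c orth nz] schauder_basis_closed_span[OF fund e c orth nz]
      span_range_subset_closed_span[OF fund e c orth nz]; assumption)+
  interpret D: nonarch_space scl v ?D
    by unfold_locales (rule complete_field sub)+
  have fundD: "D.fundamental (subtopology T ?D) q"
    by (rule fundamental_subtopology[OF fund sub sub2])
  have "Hausdorff_space (subtopology T ?D)" using Haus by (rule Hausdorff_space_subtopology)
  note norm_iff = D.normable_fundamental_iff[OF fundD this]
  have "\<not> normable v scl (subtopology T ?D)"
  proof
    assume "normable v scl (subtopology T ?D)"
    then obtain k where k: "\<And>j. dominated_on ?D (q j) (q k)" unfolding norm_iff by blast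
    obtain j where j: "\<forall>C. \<exists>n. C * q k (e n) < q j (e n)" using unbounded by blast
    obtain C where "\<And>x. x \<in> ?D \<Longrightarrow> q j x \<le> C * q k x"
      using k unfolding dominated_on_def by blast
    moreover obtain n where "C * q k (e n) < q j (e n)" using j by blast
    moreover have "e n \<in> ?D" using ran span_superset by blast
    ultimately show False using linorder_not_le by blast
  qed
  then show ?thesis using sub clo bas by blast
qed

section \<open>Functionals on spaces of countable dimension\<close>

definition linear_on :: "'a set \<Rightarrow> ('a \<Rightarrow> 'k) \<Rightarrow> bool" where
  "linear_on S \<phi> \<longleftrightarrow> (\<forall>x\<in>S. \<forall>y\<in>S. \<phi> (x + y) = \<phi> x + \<phi> y) \<and> (\<forall>a. \<forall>x\<in>S. \<phi> (a \<odot> x) = a * \<phi> x)"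

lemma linear_on_add: "linear_on S \<phi> \<Longrightarrow> x \<in> S \<Longrightarrow> y \<in> S \<Longrightarrow> \<phi> (x + y) = \<phi> x + \<phi> y"
  and linear_on_scale: "linear_on S \<phi> \<Longrightarrow> x \<in> S \<Longrightarrow> \<phi> (a \<odot> x) = a * \<phi> x"
  unfolding linear_on_def by blast+

lemma linear_on_diff:
  assumes "linear_on S \<phi>" "subspace S" "x \<in> S" "y \<in> S"
  shows "\<phi> (x - y) = \<phi> x - \<phi> y"
proof -
  have "\<phi> (x - y + y) = \<phi> (x - y) + \<phi> y"
    using assms by (intro linear_on_add) (auto intro: subspace_diff)
  then show ?thesis by simp
qed

lemma linear_on_subset: "linear_on S \<phi> \<Longrightarrow> S' \<subseteq> S \<Longrightarrow> linear_on S' \<phi>"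
  unfolding linear_on_def by blast

lemma subspace_kernel:
  assumes "linear_on S \<phi>" "subspace S"
  shows "subspace {x \<in> S. \<phi> x = 0}"
proof -
  have "\<phi> 0 = 0" using linear_on_diff[OF assms, of 0 0] subspace_0[OF assms(2)] by simp
  then show ?thesis
    unfolding subspace_def using assms subspace_0[OF assms(2)]
    by (auto simp: linear_on_add linear_on_scale subspace_add subspace_scale)
qed

definition adherent :: "('a \<Rightarrow> real) \<Rightarrow> 'a set \<Rightarrow> 'a \<Rightarrow> bool" where
  "adherent p S w \<longleftrightarrow> (\<forall>\<epsilon>>0. \<exists>f\<in>S. p (w - f) < \<epsilon>)"

text \<open>A bounded functional on \<open>S\<close> maps a sequence in \<open>S\<close> that converges to \<open>w\<close> to a Cauchy sequence of
  scalars, so it has a value \<open>c\<close> at \<open>w\<close> even when \<open>w\<close> is outside \<open>S\<close>. Completeness of the field enters here.\<close>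
lemma functional_limit:
  assumes p: "seminorm p" and S: "subspace S" "S \<subseteq> E" and w: "w \<in> E" "adherent p S w"
    and \<phi>: "linear_on S \<phi>" "dominated_on S (\<lambda>x. v (\<phi> x)) p"
  obtains g c where "\<And>n. g n \<in> S" "(\<lambda>n. p (w - g n)) \<longlonglongrightarrow> 0" "(\<lambda>n. v (\<phi> (g n) - c)) \<longlonglongrightarrow> 0"
proof -
  have "\<exists>f. f \<in> S \<and> p (w - f) < inverse (real (Suc n))" for n
  proof -
    have "0 < inverse (real (Suc n))" by simp
    then show ?thesis using w(2) unfolding adherent_def by blast
  qed
  then obtain g where g: "\<And>n. g n \<in> S" "\<And>n. p (w - g n) < inverse (real (Suc n))"
    by metis
  have gE: "g n \<in> E" for n using g(1) S by blast
  have g_tends: "(\<lambda>n. p (w - g n)) \<longlonglongrightarrow> 0"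
  proof (rule tendsto_sandwich[OF _ _ tendsto_const LIMSEQ_inverse_real_of_nat])
    show "\<forall>\<^sub>F n in sequentially. 0 \<le> p (w - g n)"
      by (simp add: seminorm_nonneg[OF p] diff_in_E w(1) gE)
    show "\<forall>\<^sub>F n in sequentially. p (w - g n) \<le> inverse (real (Suc n))"
      using g(2) by (simp add: less_imp_le)
  qed
  obtain C where C: "0 < C" "\<And>x. x \<in> S \<Longrightarrow> v (\<phi> x) \<le> C * p x"
    by (rule dominated_onE[OF \<phi>(2) p S(2)]) blast
  have "\<exists>N. \<forall>m\<ge>N. \<forall>n\<ge>N. v (\<phi> (g m) - \<phi> (g n)) < \<epsilon>" if \<epsilon>: "0 < \<epsilon>" for \<epsilon>
  proof -
    have "0 < \<epsilon> / C" using \<epsilon> C(1) by simp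
    from order_tendstoD(2)[OF g_tends this] obtain N where N: "\<forall>n\<ge>N. p (w - g n) < \<epsilon> / C"
      unfolding eventually_sequentially by blast
    have "v (\<phi> (g m) - \<phi> (g n)) < \<epsilon>" if "m \<ge> N" "n \<ge> N" for m n
    proof -
      have "p (g m - g n) \<le> max (p (g m - w)) (p (w - g n))"
        by (rule seminorm_triangle[OF p gE w(1) gE])
      moreover have "p (g m - w) = p (w - g m)" by (rule seminorm_minus_commute[OF p gE w(1)])
      moreover have "p (w - g m) < \<epsilon> / C" "p (w - g n) < \<epsilon> / C" using N that by auto
      ultimately have "p (g m - g n) < \<epsilon> / C" by linarith
      then have "C * p (g m - g n) < \<epsilon>" using C(1) by (simp add: pos_less_divide_eq mult.commute)
      moreover have "v (\<phi> (g m - g n)) \<le> C * p (g m - g n)"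
        by (intro C subspace_diff[OF S(1)] g(1))
      ultimately show ?thesis using linear_on_diff[OF \<phi>(1) S(1) g(1) g(1)] by simp
    qed
    then show ?thesis by blast
  qed
  then obtain c where "(\<lambda>n. v (\<phi> (g n) - c)) \<longlonglongrightarrow> 0"
    using field_Cauchy_convergent[of "\<lambda>n. \<phi> (g n)"] by blast
  with g(1) g_tends show ?thesis by (rule that)
qed

text \<open>Over a general field the distance from \<open>w\<close> to \<open>S\<close> need not be attained, but a positive distance is
  attained up to any factor \<open>t > 1\<close>.\<close>
lemma near_minimizer:
  assumes p: "seminorm p" and S: "subspace S" "S \<subseteq> E" and w: "w \<in> E" and t: "1 < t"
  obtains (attained) f0 where "f0 \<in> S" "0 < p (w - f0)" "\<And>f. f \<in> S \<Longrightarrow> p (w - f0) \<le> t * p (w - f)"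
  | (adherent) "adherent p S w"
proof (cases "adherent p S w")
  case True
  then show ?thesis by (rule adherent)
next
  case False
  then obtain \<epsilon> where \<epsilon>: "0 < \<epsilon>" "\<And>f. f \<in> S \<Longrightarrow> \<epsilon> \<le> p (w - f)"
    unfolding adherent_def by (auto simp: not_less)
  define d where "d = (INF f\<in>S. p (w - f))"
  have ne: "S \<noteq> {}" using S(1) subspace_0 by blast
  have "bdd_below ((\<lambda>f. p (w - f)) ` S)" using \<epsilon>(2) by (intro bdd_belowI2)
  then have d_le: "d \<le> p (w - f)" if "f \<in> S" for f
    unfolding d_def using that by (intro cINF_lower)
  have "\<epsilon> \<le> d" unfolding d_def using ne \<epsilon>(2) by (intro cINF_greatest)
  then have d: "0 < d" using \<epsilon>(1) by linarith
  then have "d < t * d" using t by simp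
  then have "\<exists>y\<in>(\<lambda>f. p (w - f)) ` S. y < t * d"
    using ne by (intro cInf_lessD) (auto simp: d_def)
  then obtain f0 where f0: "f0 \<in> S" "p (w - f0) < t * d" by blast
  have "p (w - f0) \<le> t * p (w - f)" if "f \<in> S" for f
  proof -
    have "t * d \<le> t * p (w - f)" using d_le[OF that] t by simp
    then show ?thesis using f0(2) by linarith
  qed
  moreover have "0 < p (w - f0)" using d d_le[OF f0(1)] by linarith
  ultimately show ?thesis using f0(1) attained by blast
qed

lemma ex_coordinate:
  assumes S: "subspace S" and w: "w \<notin> S"
  obtains \<kappa> where "linear_on (span (insert w S)) \<kappa>" "\<And>f a. f \<in> S \<Longrightarrow> \<kappa> (f + a \<odot> w) = a"
    "\<And>x. x \<in> span (insert w S) \<Longrightarrow> x - \<kappa> x \<odot> w \<in> S"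
proof -
  define \<kappa> where "\<kappa> x = (THE a. x - a \<odot> w \<in> S)" for x
  have unique: "a = b" if "x - a \<odot> w \<in> S" "x - b \<odot> w \<in> S" for x a b
  proof (rule ccontr)
    assume ab: "a \<noteq> b"
    have "(x - b \<odot> w) - (x - a \<odot> w) \<in> S" by (rule subspace_diff[OF S that(2,1)])
    moreover have "(x - b \<odot> w) - (x - a \<odot> w) = (a - b) \<odot> w"
      by (simp add: scale_left_diff_distrib)
    ultimately have "(a - b) \<odot> w \<in> S" by simp
    from subspace_scale[OF S this, of "inverse (a - b)"] show False using w ab by simp
  qed
  have \<kappa>_eq: "\<kappa> x = a" if "x - a \<odot> w \<in> S" for x a
    unfolding \<kappa>_def using that unique by blast
  have \<kappa>_mem: "x - \<kappa> x \<odot> w \<in> S" if x: "x \<in> span (insert w S)" for x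
  proof -
    obtain a where "x - a \<odot> w \<in> span S" using x unfolding span_breakdown_eq by blast
    then have "x - a \<odot> w \<in> S" using span_eq_iff[THEN iffD2, OF S] by simp
    then show ?thesis using \<kappa>_eq by simp
  qed
  have "linear_on (span (insert w S)) \<kappa>"
    unfolding linear_on_def
  proof (intro conjI ballI allI)
    fix x y assume "x \<in> span (insert w S)" "y \<in> span (insert w S)"
    then have "(x - \<kappa> x \<odot> w) + (y - \<kappa> y \<odot> w) \<in> S"
      using S \<kappa>_mem by (intro subspace_add)
    then show "\<kappa> (x + y) = \<kappa> x + \<kappa> y"
      by (intro \<kappa>_eq) (simp add: scale_left_distrib algebra_simps)
  next
    fix a x assume "x \<in> span (insert w S)"
    then have "a \<odot> (x - \<kappa> x \<odot> w) \<in> S" using S \<kappa>_mem by (intro subspace_scale)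
    then show "\<kappa> (a \<odot> x) = a * \<kappa> x"
      by (intro \<kappa>_eq) (simp add: scale_right_diff_distrib)
  qed
  moreover have "\<kappa> (f + a \<odot> w) = a" if "f \<in> S" for f a
    using that by (intro \<kappa>_eq) simp
  ultimately show ?thesis using \<kappa>_mem that by blast
qed

text \<open>It is enough to find a value \<open>c\<close> at \<open>w\<close> with \<open>v (c - \<phi> f) \<le> C' * p (w - f)\<close> on \<open>S\<close>. If \<open>f0\<close> is a nearest
  point of \<open>S\<close> up to the factor \<open>C' / C\<close>, then \<open>c = \<phi> f0\<close> works by the ultrametric inequality; if the
  distance is zero, \<open>c\<close> is the limit of \<open>\<phi>\<close> along a sequence converging to \<open>w\<close>.\<close>
lemma extend_functional_one:
  assumes p: "seminorm p" and S: "subspace S" "S \<subseteq> E" and w: "w \<in> E"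
    and \<phi>: "linear_on S \<phi>" "\<And>x. x \<in> S \<Longrightarrow> v (\<phi> x) \<le> C * p x" and C: "0 < C" "C < C'"
  shows "\<exists>\<psi>. linear_on (span (insert w S)) \<psi> \<and> (\<forall>x\<in>S. \<psi> x = \<phi> x) \<and>
    (\<forall>x\<in>span (insert w S). v (\<psi> x) \<le> C' * p x)"
proof -
  have C_le: "C * p x \<le> C' * p x" if "x \<in> E" for x
    using C seminorm_nonneg[OF p that] by (intro mult_right_mono) auto
  have "\<exists>c. \<forall>f\<in>S. v (c - \<phi> f) \<le> C' * p (w - f)"
  proof -
    have "1 < C' / C" using C by simp
    from p S w this show ?thesis
    proof (cases rule: near_minimizer)
      case (attained f0)
      have "v (\<phi> f0 - \<phi> f) \<le> C' * p (w - f)" if f: "f \<in> S" for f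
      proof -
        have E: "f \<in> E" "f0 \<in> E" using f attained(1) S by auto
        have "p (w - f0) \<le> C' / C * p (w - f)" by (rule attained(3)[OF f])
        then have 1: "C * p (w - f0) \<le> C' * p (w - f)" using C by (simp add: field_simps)
        have "p (f0 - f) \<le> max (p (f0 - w)) (p (w - f))"
          by (rule seminorm_triangle[OF p E(2) w E(1)])
        also have "p (f0 - w) = p (w - f0)" by (rule seminorm_minus_commute[OF p E(2) w])
        finally have "C * p (f0 - f) \<le> C * max (p (w - f0)) (p (w - f))" using C by simp
        also have "\<dots> \<le> C' * p (w - f)"
          using 1 C_le[OF diff_in_E[OF w E(1)]] by (simp add: max_def)
        finally have "C * p (f0 - f) \<le> C' * p (w - f)" .
        moreover have "v (\<phi> (f0 - f)) \<le> C * p (f0 - f)"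
          using attained(1) f S by (intro \<phi> subspace_diff)
        ultimately show ?thesis
          using linear_on_diff[OF \<phi>(1) S(1) attained(1) f] by simp
      qed
      then show ?thesis by blast
    next
      case adherent
      have "dominated_on S (\<lambda>x. v (\<phi> x)) p" unfolding dominated_on_def using \<phi>(2) by blast
      then obtain g c where g: "\<And>n. g n \<in> S" "(\<lambda>n. p (w - g n)) \<longlonglongrightarrow> 0"
        and c: "(\<lambda>n. v (\<phi> (g n) - c)) \<longlonglongrightarrow> 0"
        by (rule functional_limit[OF p S w adherent \<phi>(1)]) blast
      have gE: "g n \<in> E" for n using g(1) S by blast
      have "v (c - \<phi> f) \<le> C' * p (w - f)" if f: "f \<in> S" for f
      proof -
        have fE: "f \<in> E" using f S by auto
        let ?R = "\<lambda>n. C' * p (w - f) + (C * p (w - g n) + v (\<phi> (g n) - c))"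
        have "?R \<longlonglongrightarrow> C' * p (w - f) + (C * 0 + 0)"
          by (intro tendsto_intros g c)
        moreover have "v (c - \<phi> f) \<le> ?R n" for n
        proof -
          have "p (g n - f) \<le> max (p (g n - w)) (p (w - f))"
            by (rule seminorm_triangle[OF p gE w fE])
          also have "p (g n - w) = p (w - g n)" by (rule seminorm_minus_commute[OF p gE w])
          finally have "p (g n - f) \<le> p (w - g n) + p (w - f)"
            using seminorm_nonneg[OF p diff_in_E[OF w fE]] seminorm_nonneg[OF p diff_in_E[OF w gE]]
            by (smt (verit))
          then have "C * p (g n - f) \<le> C * (p (w - g n) + p (w - f))" using C by simp
          moreover have "v (\<phi> (g n - f)) \<le> C * p (g n - f)"
            using g(1) f S by (intro \<phi> subspace_diff)
          moreover have "\<phi> (g n - f) = \<phi> (g n) - \<phi> f"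
            by (rule linear_on_diff[OF \<phi>(1) S(1) g(1) f])
          moreover have "C * p (w - f) \<le> C' * p (w - f)" by (rule C_le[OF diff_in_E[OF w fE]])
          ultimately have "v (\<phi> (g n) - \<phi> f) \<le> C * p (w - g n) + C' * p (w - f)"
            by (simp add: algebra_simps)
          moreover have "v (c - \<phi> f) \<le> max (v (c - \<phi> (g n))) (v (\<phi> (g n) - \<phi> f))"
            using valuation_add[of "c - \<phi> (g n)" "\<phi> (g n) - \<phi> f"] by simp
          ultimately show ?thesis
            using valuation_minus_commute[of c "\<phi> (g n)"] valuation_nonneg[of "\<phi> (g n) - c"]
              valuation_nonneg[of "\<phi> (g n) - \<phi> f"] by linarith
        qed
        ultimately show ?thesis using LIMSEQ_le_const[of ?R] by simp
      qed
      then show ?thesis by blast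
    qed
  qed
  then obtain c where c: "\<And>f. f \<in> S \<Longrightarrow> v (c - \<phi> f) \<le> C' * p (w - f)" by blast
  show ?thesis
  proof (cases "w \<in> S")
    case True
    then have "span (insert w S) = S" using S by (simp add: insert_absorb)
    moreover have "v (\<phi> x) \<le> C' * p x" if "x \<in> S" for x
      using \<phi>(2)[OF that] C_le[of x] that S by force
    ultimately show ?thesis using \<phi>(1) by (intro exI[of _ \<phi>]) auto
  next
    case False
    obtain \<kappa> where \<kappa>: "linear_on (span (insert w S)) \<kappa>" "\<And>f a. f \<in> S \<Longrightarrow> \<kappa> (f + a \<odot> w) = a"
      "\<And>x. x \<in> span (insert w S) \<Longrightarrow> x - \<kappa> x \<odot> w \<in> S"
      by (rule ex_coordinate[OF S(1) False]) blast
    define \<psi> where "\<psi> x = \<phi> (x - \<kappa> x \<odot> w) + \<kappa> x * c" for x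
    have "linear_on (span (insert w S)) \<psi>"
      unfolding linear_on_def
    proof (intro conjI ballI allI)
      fix x y assume x: "x \<in> span (insert w S)" and y: "y \<in> span (insert w S)"
      have "x + y - \<kappa> (x + y) \<odot> w = (x - \<kappa> x \<odot> w) + (y - \<kappa> y \<odot> w)"
        using linear_on_add[OF \<kappa>(1) x y] by (simp add: scale_left_distrib)
      then show "\<psi> (x + y) = \<psi> x + \<psi> y"
        unfolding \<psi>_def using linear_on_add[OF \<phi>(1) \<kappa>(3)[OF x] \<kappa>(3)[OF y]] linear_on_add[OF \<kappa>(1) x y]
        by (simp add: algebra_simps)
    next
      fix a x assume x: "x \<in> span (insert w S)"
      have "a \<odot> x - \<kappa> (a \<odot> x) \<odot> w = a \<odot> (x - \<kappa> x \<odot> w)"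
        using linear_on_scale[OF \<kappa>(1) x] by (simp add: scale_right_diff_distrib)
      then show "\<psi> (a \<odot> x) = a * \<psi> x"
        unfolding \<psi>_def using linear_on_scale[OF \<phi>(1) \<kappa>(3)[OF x]] linear_on_scale[OF \<kappa>(1) x]
        by (simp add: algebra_simps)
    qed
    moreover have "\<psi> x = \<phi> x" if "x \<in> S" for x
      using \<kappa>(2)[OF that, of 0] by (simp add: \<psi>_def)
    moreover have "v (\<psi> x) \<le> C' * p x" if x: "x \<in> span (insert w S)" for x
    proof (cases "\<kappa> x = 0")
      case True
      then have "x \<in> S" using \<kappa>(3)[OF x] by simp
      then show ?thesis
        using \<phi>(2)[of x] C_le[of x] S True by (force simp: \<psi>_def)
    next
      case nz: False
      \<comment> \<open>Dividing by the coefficient of \<open>w\<close> reduces the bound to the one for \<open>c\<close>.\<close>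
      define f where "f = - inverse (\<kappa> x) \<odot> (x - \<kappa> x \<odot> w)"
      have f: "f \<in> S" unfolding f_def by (rule subspace_scale[OF S(1) \<kappa>(3)[OF x]])
      have "\<kappa> x \<odot> (w - f) = x"
        using nz by (simp add: f_def scale_right_diff_distrib)
      moreover have "w - f \<in> E" using f S w by (auto intro: diff_in_E)
      ultimately have px: "p x = v (\<kappa> x) * p (w - f)"
        using seminorm_scale[OF p, of "w - f" "\<kappa> x"] by simp
      have "\<phi> f = - inverse (\<kappa> x) * \<phi> (x - \<kappa> x \<odot> w)"
        unfolding f_def by (rule linear_on_scale[OF \<phi>(1) \<kappa>(3)[OF x]])
      then have "\<psi> x = \<kappa> x * (c - \<phi> f)"
        using nz by (simp add: \<psi>_def algebra_simps)
      then have "v (\<psi> x) = v (\<kappa> x) * v (c - \<phi> f)" by (simp add: valuation_mult)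
      also have "\<dots> \<le> v (\<kappa> x) * (C' * p (w - f))"
        using c[OF f] by (intro mult_left_mono) auto
      also have "\<dots> = C' * p x" by (simp add: px)
      finally show ?thesis .
    qed
    ultimately show ?thesis by blast
  qed
qed

text \<open>Adjoin one vector at a time. The constants \<open>C' - (C' - C) / 2 ^ n\<close> start at \<open>C\<close>, increase strictly, and
  stay below \<open>C'\<close>, so every single extension is possible.\<close>
lemma extend_functional_countable:
  fixes x :: "nat \<Rightarrow> 'a"
  assumes p: "seminorm p" and S: "subspace S" "S \<subseteq> E" and x: "\<And>n. x n \<in> E"
    and \<phi>: "linear_on S \<phi>" "\<And>y. y \<in> S \<Longrightarrow> v (\<phi> y) \<le> C * p y" and C: "0 < C" "C < C'"
  obtains \<psi> where "linear_on (span (S \<union> range x)) \<psi>" "\<And>y. y \<in> S \<Longrightarrow> \<psi> y = \<phi> y"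
    "\<And>y. y \<in> span (S \<union> range x) \<Longrightarrow> v (\<psi> y) \<le> C' * p y"
proof -
  define F where "F n = span (S \<union> x ` {..<n})" for n
  define c where "c n = C' - (C' - C) / 2 ^ n" for n :: nat
  have c_pos: "0 < c n" for n
  proof -
    have "(C' - C) / 2 ^ n \<le> C' - C"
      using C mult_left_mono[of 1 "2 ^ n" "C' - C"] by (simp add: divide_le_eq)
    then show ?thesis using C unfolding c_def by linarith
  qed
  have c_mono: "c n < c (Suc n)" for n
  proof -
    have "(C' - C) / 2 ^ Suc n < (C' - C) / 2 ^ n" using C by (intro divide_strict_left_mono) auto
    then show ?thesis unfolding c_def by linarith
  qed
  have c_le: "c n \<le> C'" for n using C by (simp add: c_def)
  have F_E: "F n \<subseteq> E" for n
    unfolding F_def using S x by (intro span_minimal[OF _ subspace_E]) auto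
  have F_sub: "subspace (F n)" for n
    unfolding F_def by (rule subspace_span)
  have F_Suc: "F (Suc n) = span (insert (x n) (F n))" for n
  proof -
    have "S \<union> x ` {..<Suc n} = insert (x n) (S \<union> x ` {..<n})" by (auto simp: lessThan_Suc)
    then show ?thesis unfolding F_def by (simp add: span_insert span_span)
  qed
  have F0: "F 0 = S" using S by (simp add: F_def)
  have F_mono: "F m \<subseteq> F n" if "m \<le> n" for m n
    unfolding F_def using that by (intro span_mono) auto
  let ?P = "\<lambda>n \<psi>. linear_on (F n) \<psi> \<and> (\<forall>y\<in>S. \<psi> y = \<phi> y) \<and> (\<forall>y\<in>F n. v (\<psi> y) \<le> c n * p y)"
  let ?Q = "\<lambda>n \<psi> \<psi>'. \<forall>y\<in>F n. \<psi>' y = \<psi> y"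
  have "\<exists>\<Psi>. \<forall>n. ?P n (\<Psi> n) \<and> ?Q n (\<Psi> n) (\<Psi> (Suc n))"
  proof (rule dependent_nat_choice)
    have "c 0 = C" by (simp add: c_def)
    then show "\<exists>\<psi>. ?P 0 \<psi>" using \<phi> F0 by auto
  next
    fix \<psi> n assume P: "?P n \<psi>"
    have "\<exists>\<psi>'. linear_on (span (insert (x n) (F n))) \<psi>' \<and> (\<forall>y\<in>F n. \<psi>' y = \<psi> y) \<and>
        (\<forall>y\<in>span (insert (x n) (F n)). v (\<psi>' y) \<le> c (Suc n) * p y)"
      using P by (intro extend_functional_one[OF p F_sub F_E x _ _ c_pos c_mono]) auto
    from this[folded F_Suc] obtain \<psi>' where \<psi>': "linear_on (F (Suc n)) \<psi>'" "\<forall>y\<in>F n. \<psi>' y = \<psi> y"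
        "\<forall>y\<in>F (Suc n). v (\<psi>' y) \<le> c (Suc n) * p y"
      by blast
    have "S \<subseteq> F n" using F_mono[of 0 n] F0 by simp
    then have "\<forall>y\<in>S. \<psi>' y = \<phi> y" using \<psi>'(2) P by (simp add: subset_iff)
    then show "\<exists>\<psi>'. ?P (Suc n) \<psi>' \<and> ?Q n \<psi> \<psi>'" by (intro exI[of _ \<psi>'] conjI \<psi>')
  qed
  then obtain \<Psi> where \<Psi>: "\<And>n. ?P n (\<Psi> n)" "\<And>n. ?Q n (\<Psi> n) (\<Psi> (Suc n))" by blast
  have agree: "\<Psi> n y = \<Psi> m y" if "m \<le> n" "y \<in> F m" for m n y
    using that(1)
  proof (induction n rule: dec_induct)
    case (step n)
    have "y \<in> F n" using F_mono[OF step(1)] that(2) by blast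
    then show ?case using \<Psi>(2) step.IH by simp
  qed simp
  have union: "\<exists>n. y \<in> F n" if "y \<in> span (S \<union> range x)" for y
    using that
  proof (induction rule: span_induct_alt)
    case base
    show ?case using subspace_0[OF F_sub] by blast
  next
    case (step a z y)
    then obtain n where n: "y \<in> F n" by blast
    obtain m where m: "z \<in> F m"
    proof (cases "z \<in> S")
      case True
      then show ?thesis using F0 that by blast
    next
      case False
      then obtain k where "z = x k" using step by blast
      then have "z \<in> F (Suc k)" unfolding F_Suc by (simp add: span_base)
      then show ?thesis by (rule that)
    qed
    have "z \<in> F (max m n)" "y \<in> F (max m n)"
      using m n F_mono[of m "max m n"] F_mono[of n "max m n"] by auto
    then show ?case using F_sub by (meson subspace_add subspace_scale)
  qed
  define \<psi> where "\<psi> y = \<Psi> (LEAST n. y \<in> F n) y" for y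
  have \<psi>_eq: "\<psi> y = \<Psi> n y" if "y \<in> F n" for n y
    unfolding \<psi>_def 
    using that LeastI[of "\<lambda>n. y \<in> F n" n] by (intro agree[symmetric] Least_le)
  have "linear_on (span (S \<union> range x)) \<psi>"
    unfolding linear_on_def
  proof (intro conjI ballI allI)
    fix y z assume "y \<in> span (S \<union> range x)" "z \<in> span (S \<union> range x)"
    then obtain m n where "y \<in> F m" "z \<in> F n" using union by blast
    then have yz: "y \<in> F (max m n)" "z \<in> F (max m n)"
      using F_mono[of m "max m n"] F_mono[of n "max m n"] by auto
    then have "y + z \<in> F (max m n)" using F_sub by (meson subspace_add)
    then show "\<psi> (y + z) = \<psi> y + \<psi> z"
      using yz linear_on_add[OF conjunct1[OF \<Psi>(1)] yz] by (simp add: \<psi>_eq)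
  next
    fix a y assume "y \<in> span (S \<union> range x)"
    then obtain n where n: "y \<in> F n" using union by blast
    then have "a \<odot> y \<in> F n" using F_sub by (meson subspace_scale)
    then show "\<psi> (a \<odot> y) = a * \<psi> y"
      using n linear_on_scale[OF conjunct1[OF \<Psi>(1)] n] by (simp add: \<psi>_eq)
  qed
  moreover have "\<psi> y = \<phi> y" if "y \<in> S" for y
    using that \<Psi>(1)[of 0] \<psi>_eq[of y 0] F0 by simp
  moreover have "v (\<psi> y) \<le> C' * p y" if y: "y \<in> span (S \<union> range x)" for y
  proof -
    obtain n where n: "y \<in> F n" using union[OF y] by blast
    then have "v (\<psi> y) \<le> c n * p y" using \<Psi>(1)[of n] by (simp add: \<psi>_eq)
    also have "\<dots> \<le> C' * p y"
      using n F_E c_le by (intro mult_right_mono seminorm_nonneg[OF p]) auto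
    finally show ?thesis .
  qed
  ultimately show ?thesis by (rule that)
qed

text \<open>Continuity is measured by one seminorm; for increasing seminorms this is continuity for the topology
  that they generate.\<close>
definition continuous_functional :: "'a set \<Rightarrow> ('a \<Rightarrow> real) \<Rightarrow> ('a \<Rightarrow> 'k) \<Rightarrow> bool" where
  "continuous_functional L p \<phi> \<longleftrightarrow> linear_on L \<phi> \<and> dominated_on L (\<lambda>x. v (\<phi> x)) p"

text \<open>Induction on \<open>n\<close>. If the new vector can be approximated by the span of the previous ones, the old
  functionals still do. Otherwise subtract a nearly closest point to get a vector \<open>w\<close> almost orthogonal
  to the previous span, and extend its coordinate functional to the whole space: where this functional
  vanishes at \<open>g\<close>, it bounds the \<open>w\<close>-component of \<open>f\<close> in terms of \<open>f + g\<close>, and the induction hypothesis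
  bounds the rest.\<close>
lemma ex_orthogonal_kernel:
  fixes x e :: "nat \<Rightarrow> 'a"
  assumes p: "seminorm p" and x: "\<And>n. x n \<in> E" and e: "\<And>k. k < n \<Longrightarrow> e k \<in> span (range x)" and t: "1 < t"
  shows "\<exists>\<Phi>. finite \<Phi> \<and> (\<forall>\<phi>\<in>\<Phi>. continuous_functional (span (range x)) p \<phi>) \<and>
    (\<forall>f\<in>span (e ` {..<n}). \<forall>g\<in>span (range x). (\<forall>\<phi>\<in>\<Phi>. \<phi> g = 0) \<longrightarrow> p f \<le> t * p (f + g))"
  using e t
proof (induction n arbitrary: t)
  case 0
  have "p 0 \<le> t * p g" if "g \<in> span (range x)" for g
  proof -
    have "g \<in> E" using that x span_minimal[OF _ subspace_E, of "range x"] by blast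
    then show ?thesis using seminorm_zero[OF p] seminorm_nonneg[OF p] 0 by simp
  qed
  then show ?case by (intro exI[of _ "{}"]) auto
next
  case (Suc n)
  let ?L = "span (range x)" and ?S = "span (e ` {..<n})"
  have LE: "?L \<subseteq> E" using x by (intro span_minimal[OF _ subspace_E]) auto
  have SL: "?S \<subseteq> ?L" using Suc.prems(1) by (intro span_minimal) auto
  have SE: "?S \<subseteq> E" using SL LE by blast
  have wL: "e n \<in> ?L" using Suc.prems by simp
  then have wE: "e n \<in> E" using LE by blast
  have span_Suc: "span (e ` {..<Suc n}) = span (insert (e n) ?S)"
    by (simp add: lessThan_Suc span_insert span_span)
  \<comment> \<open>The factor is lost three times: nearest point, extension, induction hypothesis.\<close>
  define s where "s = root 3 t"
  have s: "1 < s" "s ^ 3 = t" using Suc.prems(2) by (simp_all add: s_def)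
  have s_le: "s \<le> t" "s ^ 2 \<le> t" using s power_increasing[of 1 3 s] power_increasing[of 2 3 s] by auto
  obtain \<Phi> where \<Phi>: "finite \<Phi>" "\<forall>\<phi>\<in>\<Phi>. continuous_functional ?L p \<phi>"
    "\<And>f g. f \<in> ?S \<Longrightarrow> g \<in> ?L \<Longrightarrow> \<forall>\<phi>\<in>\<Phi>. \<phi> g = 0 \<Longrightarrow> p f \<le> s * p (f + g)"
    using Suc.IH[of s] Suc.prems s(1) by auto
  from p subspace_span SE wE s(1) show ?case
  proof (cases rule: near_minimizer)
    case adherent
    have "p f \<le> t * p (f + g)"
      if f: "f \<in> span (insert (e n) ?S)" and g: "g \<in> ?L" "\<forall>\<phi>\<in>\<Phi>. \<phi> g = 0" for f g
    proof (rule field_le_epsilon)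
      fix \<epsilon> :: real assume \<epsilon>: "0 < \<epsilon>"
      obtain a where a: "f - a \<odot> e n \<in> ?S" 
        using f unfolding span_breakdown_eq span_span by blast
      define \<delta> where "\<delta> = \<epsilon> / (s * (v a + 1))"
      have va: "0 < v a + 1" using valuation_nonneg[of a] by linarith
      have "0 < \<delta>" unfolding \<delta>_def using \<epsilon> va s by simp
      then obtain h where h: "h \<in> ?S" "p (e n - h) < \<delta>" using adherent unfolding adherent_def by blast
      define f' where "f' = (f - a \<odot> e n) + a \<odot> h"
      have f': "f' \<in> ?S" unfolding f'_def by (intro span_add a span_scale h)
      have hE: "h \<in> E" and f'E: "f' \<in> E" using h f' SE by auto
      have "f \<in> span (e ` {..<Suc n})" using f span_Suc by simp
      moreover have "span (e ` {..<Suc n}) \<subseteq> ?L"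
        using Suc.prems(1) by (intro span_minimal) auto
      ultimately have fE: "f \<in> E" using LE by blast
      have gE: "g \<in> E" using g LE by blast
      have "f - f' = a \<odot> (e n - h)" by (simp add: f'_def scale_right_diff_distrib)
      then have "p (f - f') = v a * p (e n - h)"
        using seminorm_scale[OF p diff_in_E[OF wE hE]] by simp
      also have "\<dots> \<le> (v a + 1) * p (e n - h)"
        using seminorm_nonneg[OF p diff_in_E[OF wE hE]] by (intro mult_right_mono) auto
      also have "\<dots> \<le> (v a + 1) * \<delta>" using h(2) va by simp
      also have "\<dots> = \<epsilon> / s" using va by (simp add: \<delta>_def)
      finally have d: "p (f - f') \<le> \<epsilon> / s" .
      have eps: "\<epsilon> / s \<le> \<epsilon>" using \<epsilon> s by (simp add: divide_le_eq)
      have fg: "0 \<le> p (f + g)" by (intro seminorm_nonneg[OF p] add_in_E fE gE)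
      have "p (f' + g) \<le> max (p ((f' + g) - (f + g))) (p (f + g))"
        by (intro seminorm_le_max_diff[OF p] add_in_E fE f'E gE)
      moreover have "p ((f' + g) - (f + g)) = p (f - f')"
        using seminorm_minus_commute[OF p fE f'E] by simp
      ultimately have "p (f' + g) \<le> p (f + g) + \<epsilon> / s"
        using d fg divide_pos_pos[OF \<epsilon>, of s] s by linarith
      then have "s * p (f' + g) \<le> s * (p (f + g) + \<epsilon> / s)" using s by simp
      also have "\<dots> = s * p (f + g) + \<epsilon>" using s by (simp add: algebra_simps)
      finally have "p f' \<le> s * p (f + g) + \<epsilon>" using \<Phi>(3)[OF f' g] by linarith
      moreover have "s * p (f + g) \<le> t * p (f + g)" using s_le fg by (intro mult_right_mono)
      moreover have "p f \<le> max (p (f - f')) (p f')" by (rule seminorm_le_max_diff[OF p fE f'E])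
      moreover have "0 \<le> t * p (f + g)" using fg Suc.prems(2) by simp
      ultimately show "p f \<le> t * p (f + g) + \<epsilon>" using d eps by linarith
    qed
    then show ?thesis unfolding span_Suc using \<Phi>(1,2) by blast
  next
    case (attained f0)
    define w where "w = e n - f0"
    have f0E: "f0 \<in> E" using attained(1) SE by blast
    have wE': "w \<in> E" unfolding w_def by (intro diff_in_E wE f0E)
    have pw: "0 < p w" using attained(2) by (simp add: w_def)
    have w_min: "p w \<le> s * p (w - f)" if "f \<in> ?S" for f
      using attained(3)[of "f0 + f"] that attained(1) by (simp add: w_def span_add algebra_simps)
    have w_notin: "w \<notin> ?S"
    proof
      assume "w \<in> ?S"
      then have "p w \<le> 0" using w_min[of w] by (simp add: seminorm_zero[OF p])
      then show False using pw by simp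
    qed
    have span_w: "span (insert (e n) ?S) = span (insert w ?S)"
    proof -
      have "y - a \<odot> e n \<in> ?S \<longleftrightarrow> y - a \<odot> w \<in> ?S" for y a
      proof -
        have "(y - a \<odot> w) - (y - a \<odot> e n) \<in> ?S"
          using attained(1) by (simp add: w_def scale_right_diff_distrib span_scale)
        then show ?thesis by (metis add_diff_cancel_left' diff_add_cancel span_add_eq2)
      qed
      then show ?thesis by (simp add: set_eq_iff span_breakdown_eq span_span)
    qed
    obtain \<kappa> where \<kappa>: "linear_on (span (insert w ?S)) \<kappa>" "\<And>f a. f \<in> ?S \<Longrightarrow> \<kappa> (f + a \<odot> w) = a"
      "\<And>y. y \<in> span (insert w ?S) \<Longrightarrow> y - \<kappa> y \<odot> w \<in> ?S"
      by (rule ex_coordinate[OF subspace_span w_notin]) blast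
    have wsE: "span (insert w ?S) \<subseteq> E"
      using wE' SE by (intro span_minimal[OF _ subspace_E]) auto
    have \<kappa>_bound: "v (\<kappa> y) \<le> s / p w * p y" if y: "y \<in> span (insert w ?S)" for y
    proof (cases "\<kappa> y = 0")
      case True
      then show ?thesis using y wsE seminorm_nonneg[OF p, of y] s pw by auto
    next
      case nz: False
      define f where "f = - inverse (\<kappa> y) \<odot> (y - \<kappa> y \<odot> w)"
      have f: "f \<in> ?S" unfolding f_def by (intro span_scale \<kappa>(3) y)
      have "\<kappa> y \<odot> (w - f) = y" using nz by (simp add: f_def scale_right_diff_distrib)
      moreover have "w - f \<in> E" using f SE wE' by (auto intro: diff_in_E)
      ultimately have py: "p y = v (\<kappa> y) * p (w - f)"
        using seminorm_scale[OF p, of "w - f" "\<kappa> y"] by simp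
      have "v (\<kappa> y) * p w \<le> v (\<kappa> y) * (s * p (w - f))"
        by (intro mult_left_mono w_min f) simp
      then show ?thesis using pw by (simp add: py field_simps)
    qed
    have less: "s / p w < s ^ 2 / p w"
      using s pw by (intro divide_strict_right_mono) (auto simp: power2_eq_square)
    have pos: "0 < s / p w" using s pw by simp
    obtain \<psi> where \<psi>: "linear_on (span (span (insert w ?S) \<union> range x)) \<psi>"
      "\<And>y. y \<in> span (insert w ?S) \<Longrightarrow> \<psi> y = \<kappa> y"
      "\<And>y. y \<in> span (span (insert w ?S) \<union> range x) \<Longrightarrow> v (\<psi> y) \<le> s ^ 2 / p w * p y"
      by (rule extend_functional_countable[where x = x, OF p subspace_span wsE x \<kappa>(1) \<kappa>_bound pos less])
        (assumption | blast)+
    have wL': "w \<in> ?L" unfolding w_def using wL attained(1) SL by (blast intro: span_diff)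
    have wsL: "span (insert w ?S) \<subseteq> ?L" using wL' SL by (intro span_minimal) auto
    have L_eq: "span (span (insert w ?S) \<union> range x) = ?L"
    proof
      show "span (span (insert w ?S) \<union> range x) \<subseteq> ?L"
        using wsL span_superset by (intro span_minimal) auto
      show "?L \<subseteq> span (span (insert w ?S) \<union> range x)" by (intro span_mono) auto
    qed
    note \<psi> = \<psi>[unfolded L_eq]
    have "continuous_functional ?L p \<psi>"
      unfolding continuous_functional_def dominated_on_def using \<psi>(1,3) by blast
    moreover have "p f \<le> t * p (f + g)"
      if f: "f \<in> span (insert w ?S)" and g: "g \<in> ?L" "\<forall>\<phi>\<in>insert \<psi> \<Phi>. \<phi> g = 0" for f g
    proof -
      define h where "h = f - \<kappa> f \<odot> w"
      have h: "h \<in> ?S" unfolding h_def by (rule \<kappa>(3)[OF f])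
      have E: "h \<in> E" "g \<in> E" "f \<in> E" using h SE g LE f wsE by auto
      have fL: "f \<in> ?L" using f wsL by blast
      let ?r = "p (f + g)"
      have r: "0 \<le> ?r" by (intro seminorm_nonneg[OF p] add_in_E E)
      have "\<psi> (f + g) = \<kappa> f"
        using linear_on_add[OF \<psi>(1) fL g(1)] \<psi>(2)[OF f] g(2) by simp
      then have "v (\<kappa> f) \<le> s ^ 2 / p w * ?r"
        using \<psi>(3)[of "f + g"] fL g(1) by (simp add: span_add)
      then have aw: "p (\<kappa> f \<odot> w) \<le> s ^ 2 * ?r"
        using pw by (simp add: seminorm_scale[OF p wE'] field_simps)
      have "p (h + g) \<le> max (p ((h + g) - (f + g))) ?r"
        by (intro seminorm_le_max_diff[OF p] add_in_E E)
      moreover have "(h + g) - (f + g) = - (\<kappa> f \<odot> w)" by (simp add: h_def)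
      moreover have "p (- (\<kappa> f \<odot> w)) = p (\<kappa> f \<odot> w)"
        by (intro seminorm_minus[OF p] scale_in_E wE')
      moreover have "1 * ?r \<le> s ^ 2 * ?r" using s r by (intro mult_right_mono) (auto intro: one_le_power)
      ultimately have "p (h + g) \<le> s ^ 2 * ?r" using aw by simp
      then have "s * p (h + g) \<le> s * (s ^ 2 * ?r)" using s by simp
      moreover have "s * (s ^ 2 * ?r) = t * ?r"
        unfolding s(2)[symmetric] by (simp add: power2_eq_square power3_eq_cube)
      ultimately have "p h \<le> t * ?r" using \<Phi>(3)[OF h g(1)] g(2) by auto
      moreover have "s ^ 2 * ?r \<le> t * ?r" using s_le r by (intro mult_right_mono)
      moreover have "p (h + \<kappa> f \<odot> w) \<le> max (p h) (p (\<kappa> f \<odot> w))"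
        by (intro seminorm_add[OF p] scale_in_E E wE')
      then have "p f \<le> max (p h) (p (\<kappa> f \<odot> w))" by (simp add: h_def)
      ultimately show ?thesis using aw by linarith
    qed
    ultimately show ?thesis
      unfolding span_Suc span_w using \<Phi>(1,2) by (intro exI[of _ "insert \<psi> \<Phi>"]) auto
  qed
qed

section \<open>Domination on subspaces of finite codimension\<close>

text \<open>Split off a multiple of a vector on which the functional is \<open>1\<close>; the functional controls its size.\<close>
lemma dominated_on_kernel:
  assumes p: "seminorm p" and q: "seminorm q" and V: "subspace V" "V \<subseteq> E"
    and \<phi>: "linear_on V \<phi>" "dominated_on V (\<lambda>x. v (\<phi> x)) p"
    and ker: "dominated_on {x \<in> V. \<phi> x = 0} q p"
  shows "dominated_on V q p"
proof (cases "\<forall>x\<in>V. \<phi> x = 0")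
  case True
  then have "{x \<in> V. \<phi> x = 0} = V" by blast
  then show ?thesis using ker by simp
next
  case False
  then obtain h0 where h0: "h0 \<in> V" "\<phi> h0 \<noteq> 0" by blast
  define h where "h = inverse (\<phi> h0) \<odot> h0"
  have h: "h \<in> V" "\<phi> h = 1"
    unfolding h_def using h0 V linear_on_scale[OF \<phi>(1) h0(1)] by (simp_all add: subspace_scale)
  have hE: "h \<in> E" using h V by blast
  obtain C1 where C1: "0 < C1" "\<And>x. x \<in> V \<Longrightarrow> v (\<phi> x) \<le> C1 * p x"
    by (rule dominated_onE[OF \<phi>(2) p V(2)]) blast
  have kerE: "{x \<in> V. \<phi> x = 0} \<subseteq> E" using V by blast
  obtain C2 where C2: "0 < C2" "\<And>x. x \<in> V \<Longrightarrow> \<phi> x = 0 \<Longrightarrow> q x \<le> C2 * p x"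
    by (rule dominated_onE[OF ker p kerE]) blast
  have "q x \<le> (C2 * (1 + C1 * p h) + C1 * q h) * p x" if x: "x \<in> V" for x
  proof -
    have xE: "x \<in> E" using x V by blast
    let ?u = "x - \<phi> x \<odot> h"
    have uV: "?u \<in> V" by (intro subspace_diff subspace_scale V x h)
    have uE: "?u \<in> E" using uV V by blast
    have "\<phi> ?u = 0"
      using linear_on_diff[OF \<phi>(1) V(1) x subspace_scale[OF V(1) h(1)]]
        linear_on_scale[OF \<phi>(1) h(1)] h(2) by simp
    then have qu: "q ?u \<le> C2 * p ?u" using C2(2) uV by blast
    have nn: "0 \<le> p x" "0 \<le> p h" "0 \<le> q h" "0 \<le> q ?u" "0 \<le> p ?u"
      using seminorm_nonneg[OF p xE] seminorm_nonneg[OF p hE] seminorm_nonneg[OF q hE]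
        seminorm_nonneg[OF q uE] seminorm_nonneg[OF p uE] by auto
    have a: "v (\<phi> x) \<le> C1 * p x" by (rule C1(2)[OF x])
    have "p ?u \<le> max (p x) (v (\<phi> x) * p h)"
      using seminorm_diff[OF p xE scale_in_E[OF hE]] by (simp add: seminorm_scale[OF p hE])
    moreover have "v (\<phi> x) * p h \<le> C1 * p x * p h" by (rule mult_right_mono[OF a nn(2)])
    moreover have "0 \<le> C1 * p x * p h" using C1 nn by simp
    ultimately have "p ?u \<le> p x + C1 * p x * p h" using nn by linarith
    then have "C2 * p ?u \<le> C2 * (p x + C1 * p x * p h)" using C2(1) by simp
    then have "q ?u \<le> C2 * (1 + C1 * p h) * p x" using qu by (simp add: algebra_simps)
    moreover have "q (?u + \<phi> x \<odot> h) \<le> max (q ?u) (v (\<phi> x) * q h)"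
      using seminorm_add[OF q uE scale_in_E[OF hE], of "\<phi> x"] by (simp add: seminorm_scale[OF q hE])
    then have "q x \<le> max (q ?u) (v (\<phi> x) * q h)" by simp
    moreover have "v (\<phi> x) * q h \<le> C1 * q h * p x"
      using mult_right_mono[OF a nn(3)] by (simp add: algebra_simps)
    moreover have "0 \<le> v (\<phi> x) * q h" using nn by simp
    ultimately have "q x \<le> C2 * (1 + C1 * p h) * p x + C1 * q h * p x" using nn by linarith
    then show ?thesis by (simp add: distrib_right)
  qed
  then show ?thesis unfolding dominated_on_def by blast
qed

text \<open>An unbounded functional takes the value \<open>\<phi> x\<close> on vectors of arbitrarily small seminorm, and subtracting
  such a vector from \<open>x\<close> leads into the kernel.\<close>
lemma kernel_dense:
  assumes p: "seminorm p" and V: "subspace V" "V \<subseteq> E" and \<phi>: "linear_on V \<phi>"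
    and unbdd: "\<not> dominated_on V (\<lambda>x. v (\<phi> x)) p" and x: "x \<in> V"
  shows "adherent p {u \<in> V. \<phi> u = 0} x"
  unfolding adherent_def
proof (intro allI impI)
  fix \<epsilon> :: real assume \<epsilon>: "0 < \<epsilon>"
  show "\<exists>u\<in>{u \<in> V. \<phi> u = 0}. p (x - u) < \<epsilon>"
  proof (cases "\<phi> x = 0")
    case True
    then have "x \<in> {u \<in> V. \<phi> u = 0}" using x by blast
    then show ?thesis using \<epsilon> by (intro bexI[of _ x]) (simp_all add: seminorm_zero[OF p])
  next
    case False
    have "\<not> (\<forall>h\<in>V. v (\<phi> h) \<le> v (\<phi> x) / \<epsilon> * p h)"
      using unbdd unfolding dominated_on_def by blast
    then obtain h where h: "h \<in> V" "v (\<phi> x) / \<epsilon> * p h < v (\<phi> h)"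
      unfolding Ball_def not_all not_imp not_le by (elim exE conjE)
    have hE: "h \<in> E" using h V by blast
    have "0 \<le> v (\<phi> x) / \<epsilon> * p h" using \<epsilon> seminorm_nonneg[OF p hE] by simp
    then have "0 < v (\<phi> h)" using h(2) by linarith
    then have nz: "\<phi> h \<noteq> 0" by auto
    let ?w = "(\<phi> x / \<phi> h) \<odot> h"
    have wV: "?w \<in> V" by (intro subspace_scale V h)
    have "\<phi> (x - ?w) = 0"
      using linear_on_diff[OF \<phi> V(1) x wV] linear_on_scale[OF \<phi> h(1)] nz by simp
    moreover have "x - ?w \<in> V" by (intro subspace_diff V x wV)
    moreover have "p (x - (x - ?w)) < \<epsilon>"
    proof -
      have "p (x - (x - ?w)) = v (\<phi> x) * p h / v (\<phi> h)"
        using seminorm_scale[OF p hE, of "\<phi> x / \<phi> h"]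
        by (simp add: divide_inverse valuation_mult valuation_inverse)
      also have "\<dots> < \<epsilon>"
        using h(2) \<epsilon> \<open>0 < v (\<phi> h)\<close> by (simp add: field_simps)
      finally show ?thesis .
    qed
    ultimately show ?thesis by blast
  qed
qed

text \<open>For an unbounded functional the kernel is dense and no shift is needed. For a bounded one, \<open>\<phi>\<close> has a
  limiting value \<open>a\<close> at \<open>x\<close>, which is removed by a multiple of a vector on which \<open>\<phi>\<close> is \<open>1\<close>.\<close>
lemma adherent_kernel_shift:
  assumes p: "seminorm p" and V: "subspace V" "V \<subseteq> E" and \<phi>: "linear_on V \<phi>"
    and x: "x \<in> E" "adherent p V x"
  shows "\<exists>w\<in>V. adherent p {u \<in> V. \<phi> u = 0} (x - w)"
proof (cases "dominated_on V (\<lambda>x. v (\<phi> x)) p")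
  case False
  have "adherent p {u \<in> V. \<phi> u = 0} (x - 0)"
    unfolding adherent_def
  proof (intro allI impI)
    fix \<epsilon> :: real assume \<epsilon>: "0 < \<epsilon>"
    then obtain u where u: "u \<in> V" "p (x - u) < \<epsilon>" using x(2) unfolding adherent_def by blast
    obtain u' where u': "u' \<in> V" "\<phi> u' = 0" "p (u - u') < \<epsilon>"
      using kernel_dense[OF p V \<phi> False u(1)] \<epsilon> unfolding adherent_def by blast
    have "p (x - u') \<le> max (p (x - u)) (p (u - u'))"
      using V u(1) u'(1) by (intro seminorm_triangle[OF p x(1)]) auto
    then have "p (x - u') < \<epsilon>" using u u' by linarith
    then show "\<exists>u\<in>{u \<in> V. \<phi> u = 0}. p (x - 0 - u) < \<epsilon>" using u' by auto
  qed
  then show ?thesis using subspace_0[OF V(1)] by blast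
next
  case True
  show ?thesis
  proof (cases "\<forall>u\<in>V. \<phi> u = 0")
    case True
    then have "{u \<in> V. \<phi> u = 0} = V" by blast
    then show ?thesis using x(2) subspace_0[OF V(1)] by (intro bexI[of _ 0]) auto
  next
    case False
    then obtain h0 where h0: "h0 \<in> V" "\<phi> h0 \<noteq> 0" by blast
    define h where "h = inverse (\<phi> h0) \<odot> h0"
    have h: "h \<in> V" "\<phi> h = 1"
      unfolding h_def using h0 V linear_on_scale[OF \<phi> h0(1)] by (simp_all add: subspace_scale)
    have hE: "h \<in> E" using h V by blast
    obtain g a where g: "\<And>n. g n \<in> V" "(\<lambda>n. p (x - g n)) \<longlonglongrightarrow> 0"
      and a: "(\<lambda>n. v (\<phi> (g n) - a)) \<longlonglongrightarrow> 0"
      by (rule functional_limit[OF p V x \<phi> True]) blast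
    have "adherent p {u \<in> V. \<phi> u = 0} (x - a \<odot> h)"
      unfolding adherent_def
    proof (intro allI impI)
      fix \<epsilon> :: real assume \<epsilon>: "0 < \<epsilon>"
      have "(\<lambda>n. v (\<phi> (g n) - a) * p h) \<longlonglongrightarrow> 0" by (rule tendsto_mult_left_zero[OF a])
      from order_tendstoD(2)[OF this \<epsilon>] order_tendstoD(2)[OF g(2) \<epsilon>]
      have "\<forall>\<^sub>F n in sequentially. v (\<phi> (g n) - a) * p h < \<epsilon> \<and> p (x - g n) < \<epsilon>"
        by eventually_elim auto
      from eventually_happens'[OF sequentially_bot this]
      obtain n where n: "v (\<phi> (g n) - a) * p h < \<epsilon>" "p (x - g n) < \<epsilon>" by (elim exE conjE)
      let ?u = "g n - \<phi> (g n) \<odot> h"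
      have uV: "?u \<in> V" by (intro subspace_diff subspace_scale V g h)
      have u0: "\<phi> ?u = 0"
        using linear_on_diff[OF \<phi> V(1) g(1) subspace_scale[OF V(1) h(1)]]
          linear_on_scale[OF \<phi> h(1)] h(2) by simp
      have gE: "g n \<in> E" using g V by blast
      have eq: "x - a \<odot> h - ?u = (x - g n) + (\<phi> (g n) - a) \<odot> h"
        by (simp add: scale_left_diff_distrib)
      have "p (x - a \<odot> h - ?u) \<le> max (p (x - g n)) (v (\<phi> (g n) - a) * p h)"
        unfolding eq
        using seminorm_add[OF p diff_in_E[OF x(1) gE] scale_in_E[OF hE], of "\<phi> (g n) - a"]
        by (simp add: seminorm_scale[OF p hE])
      then have "p (x - a \<odot> h - ?u) < \<epsilon>" using n by linarith
      then show "\<exists>u\<in>{u \<in> V. \<phi> u = 0}. p (x - a \<odot> h - u) < \<epsilon>" using uV u0 by blast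
    qed
    then show ?thesis using subspace_scale[OF V(1) h(1)] by blast
  qed
qed

text \<open>Let \<open>V n\<close> be the joint kernel of the first \<open>n\<close> functionals. If \<open>q k\<close> did not dominate \<open>q j\<close> on \<open>L\<close>, some
  \<open>\<phi> n\<close> would be unbounded for \<open>q k\<close> on \<open>V n\<close>, and any \<open>x0\<close> in \<open>V n\<close> with \<open>\<phi> n x0 \<noteq> 0\<close> would be adherent
  to \<open>V (Suc n)\<close>. Starting there, the shift lemma yields vectors \<open>y m\<close> that stay adherent to
  \<open>V (Suc n + m)\<close>, change only by elements of \<open>V (Suc n + m)\<close>, and tend to zero for \<open>q k\<close>. Such
  changes keep \<open>\<phi> n\<close> constant along the sequence; since every seminorm is dominated by \<open>q k\<close> on a
  late \<open>V N\<close>, the sequence is Cauchy. Its limit \<open>l\<close> satisfies \<open>q k l = 0\<close>, so it vanishes, which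
  contradicts continuity of \<open>\<phi> n\<close>.\<close>
lemma dominated_of_kernel_chain:
  fixes \<phi> :: "nat \<Rightarrow> 'a \<Rightarrow> 'k"
  assumes fund: "fundamental T q" and compl: "complete_tvs T"
    and norm: "\<And>x. x \<in> E \<Longrightarrow> q k x = 0 \<Longrightarrow> x = 0"
    and L: "subspace L" "L \<subseteq> E"
    and \<phi>: "\<And>i. \<exists>m. continuous_functional L (q m) (\<phi> i)"
    and dom: "\<And>j. \<exists>n. dominated_on {x \<in> L. \<forall>i<n. \<phi> i x = 0} (q j) (q k)"
  shows "dominated_on L (q j) (q k)"
proof (rule ccontr)
  assume not_dom: "\<not> dominated_on L (q j) (q k)"
  note q_semi = fundamental_seminorm[OF fund]
  define V where "V n = {x \<in> L. \<forall>i<n. \<phi> i x = 0}" for n :: nat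
  have \<phi>_lin: "linear_on L (\<phi> i)" for i using \<phi> unfolding continuous_functional_def by blast
  have V_sub: "V n \<subseteq> L" "V n \<subseteq> E" for n using L by (auto simp: V_def)
  have \<phi>_lin_V: "linear_on (V n) (\<phi> i)" for n i by (rule linear_on_subset[OF \<phi>_lin V_sub(1)])
  have V_0: "V 0 = L" by (simp add: V_def)
  have V_Suc: "V (Suc n) = {x \<in> V n. \<phi> n x = 0}" for n
    by (auto simp: V_def less_Suc_eq)
  have V_subsp: "subspace (V n)" for n
  proof (induction n)
    case (Suc n)
    show ?case unfolding V_Suc by (rule subspace_kernel[OF \<phi>_lin_V Suc])
  qed (use L V_0 in simp)
  have V_mono: "V n \<subseteq> V m" if "m \<le> n" for m n using that by (auto simp: V_def)
  \<comment> \<open>The last step of the chain at which domination of \<open>q j\<close> still fails.\<close>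
  obtain n where n: "\<not> dominated_on (V n) (q j) (q k)" "dominated_on (V (Suc n)) (q j) (q k)"
  proof -
    obtain N where N: "dominated_on (V N) (q j) (q k)" using dom[of j] unfolding V_def by blast
    define M where "M = (LEAST N. dominated_on (V N) (q j) (q k))"
    have M: "dominated_on (V M) (q j) (q k)" unfolding M_def using N by (rule LeastI)
    have "M \<noteq> 0"
    proof
      assume "M = 0"
      then show False using M not_dom V_0 by simp
    qed
    then obtain n where n: "M = Suc n" by (cases M) auto
    then have "\<not> dominated_on (V n) (q j) (q k)"
      using not_less_Least[of n "\<lambda>N. dominated_on (V N) (q j) (q k)"] unfolding M_def by simp
    then show thesis using that M n by blast
  qed
  have unbdd: "\<not> dominated_on (V n) (\<lambda>x. v (\<phi> n x)) (q k)"
    using n dominated_on_kernel[OF q_semi q_semi V_subsp V_sub(2) \<phi>_lin_V] unfolding V_Suc by blast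
  have "\<not> (\<forall>x\<in>V n. \<phi> n x = 0)"
  proof
    assume "\<forall>x\<in>V n. \<phi> n x = 0"
    then have "\<forall>x\<in>V n. v (\<phi> n x) \<le> 0 * q k x" by simp
    then show False using unbdd unfolding dominated_on_def by blast
  qed
  then obtain x0 where x0: "x0 \<in> V n" "\<phi> n x0 \<noteq> 0" by blast
  have x0_adh: "adherent (q k) (V (Suc n)) x0"
    unfolding V_Suc by (rule kernel_dense[OF q_semi V_subsp V_sub(2) \<phi>_lin_V unbdd x0(1)])
  let ?P = "\<lambda>m y. y \<in> L \<and> \<phi> n y = \<phi> n x0 \<and> adherent (q k) (V (Suc n + m)) y \<and>
    (0 < m \<longrightarrow> q k y < 1 / real m)"
  let ?Q = "\<lambda>m y y'. y' - y \<in> V (Suc n + m)"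
  have "\<exists>f. \<forall>m. ?P m (f m) \<and> ?Q m (f m) (f (Suc m))"
  proof (rule dependent_nat_choice)
    show "\<exists>y. ?P 0 y" using x0 x0_adh V_sub by auto
  next
    fix y m assume P: "?P m y"
    let ?N = "Suc n + m"
    have yL: "y \<in> L" using P by blast
    have yE: "y \<in> E" using yL L by blast
    have "\<exists>w\<in>V ?N. adherent (q k) {u \<in> V ?N. \<phi> ?N u = 0} (y - w)"
      using P by (intro adherent_kernel_shift[OF q_semi V_subsp V_sub(2) \<phi>_lin_V yE]) blast
    then obtain w where w: "w \<in> V ?N" "adherent (q k) (V (Suc ?N)) (y - w)"
      unfolding V_Suc by blast
    have "0 < 1 / real (Suc m)" by simp
    then obtain u where u: "u \<in> V (Suc ?N)" "q k (y - w - u) < 1 / real (Suc m)"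
      using w(2) unfolding adherent_def by blast
    have uV: "u \<in> V ?N" using u(1) V_mono[of ?N "Suc ?N"] by auto
    have wu: "w + u \<in> V ?N" by (intro subspace_add V_subsp w uV)
    \<comment> \<open>Subtracting \<open>w\<close> moves into the closure of the next kernel, subtracting \<open>u\<close> makes \<open>q k\<close> small.\<close>
    let ?y = "y - w - u"
    have y_eq: "?y = y - (w + u)" by simp
    have wuL: "w + u \<in> L" using wu V_sub by blast
    have "?y \<in> L" unfolding y_eq by (intro subspace_diff L yL wuL)
    moreover have "\<phi> n ?y = \<phi> n x0"
    proof -
      have "\<phi> n (w + u) = 0" using wu by (simp add: V_def)
      then show ?thesis
        unfolding y_eq using linear_on_diff[OF \<phi>_lin L(1) yL wuL, of n] P by simp
    qed
    moreover have "adherent (q k) (V (Suc ?N)) ?y"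
      unfolding adherent_def
    proof (intro allI impI)
      fix \<epsilon> :: real assume "0 < \<epsilon>"
      then obtain z where z: "z \<in> V (Suc ?N)" "q k (y - w - z) < \<epsilon>"
        using w(2) unfolding adherent_def by blast
      have "z - u \<in> V (Suc ?N)" by (intro subspace_diff V_subsp z u)
      moreover have "?y - (z - u) = y - w - z" by simp
      ultimately show "\<exists>f\<in>V (Suc ?N). q k (?y - f) < \<epsilon>" using z(2) by metis
    qed
    moreover have "?y - y \<in> V ?N"
    proof -
      have "- (w + u) \<in> V ?N" by (rule subspace_neg[OF V_subsp wu])
      then show ?thesis by (simp add: y_eq)
    qed
    moreover have "Suc n + Suc m = Suc ?N" by simp
    ultimately show "\<exists>y'. ?P (Suc m) y' \<and> ?Q m y y'" using u(2) by metis
  qed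
  then obtain y where yP: "\<And>m. ?P m (y m)" and yQ: "\<And>m. ?Q m (y m) (y (Suc m))" by blast
  have yE: "y m \<in> E" for m using yP[of m] L by blast
  have y_diff: "y m' - y m \<in> V (Suc n + m)" if "m \<le> m'" for m m'
    using that
  proof (induction m' rule: dec_induct)
    case base
    show ?case using subspace_0[OF V_subsp] by simp
  next
    case (step m')
    have "y (Suc m') - y m' \<in> V (Suc n + m)"
      using yQ[of m'] V_mono[of "Suc n + m" "Suc n + m'"] step(1) by auto
    from subspace_add[OF V_subsp this step.IH] show ?case by simp
  qed
  have yk: "(\<lambda>m. q k (y m)) \<longlonglongrightarrow> 0"
  proof (rule tendsto_sandwich[OF _ _ tendsto_const lim_1_over_n])
    show "\<forall>\<^sub>F m in sequentially. 0 \<le> q k (y m)"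
      by (simp add: seminorm_nonneg[OF q_semi] yE)
    show "\<forall>\<^sub>F m in sequentially. q k (y m) \<le> 1 / of_nat m"
      using eventually_gt_at_top[of 0] by eventually_elim (use yP in \<open>auto intro: less_imp_le\<close>)
  qed
  have Cauchy: "\<exists>N. \<forall>m\<ge>N. \<forall>m'\<ge>N. q i (y m - y m') < \<epsilon>" if \<epsilon>: "0 < \<epsilon>" for i \<epsilon>
  proof -
    obtain N0 where N0: "dominated_on (V N0) (q i) (q k)" using dom[of i] unfolding V_def by blast
    obtain C where C: "0 < C" "\<And>x. x \<in> V N0 \<Longrightarrow> q i x \<le> C * q k x"
      by (rule dominated_onE[OF N0 q_semi V_sub(2)]) blast
    have "0 < \<epsilon> / C" using \<epsilon> C by simp
    from order_tendstoD(2)[OF yk this] obtain N1 where N1: "\<forall>m\<ge>N1. q k (y m) < \<epsilon> / C"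
      unfolding eventually_sequentially by blast
    have half: "q i (y m' - y m) < \<epsilon>" if m: "max N0 N1 \<le> m" "m \<le> m'" for m m'
    proof -
      have "V (Suc n + m) \<subseteq> V N0" using m by (intro V_mono) auto
      then have "q i (y m' - y m) \<le> C * q k (y m' - y m)"
        using y_diff[OF m(2)] C(2) by blast
      moreover have "q k (y m' - y m) \<le> max (q k (y m')) (q k (y m))"
        by (intro seminorm_diff[OF q_semi] yE)
      moreover have "q k (y m') < \<epsilon> / C" "q k (y m) < \<epsilon> / C" using N1 m by auto
      ultimately have "q k (y m' - y m) < \<epsilon> / C" by linarith
      then have "C * q k (y m' - y m) < \<epsilon>" using C(1) by (simp add: pos_less_divide_eq mult.commute)
      then show ?thesis using \<open>q i (y m' - y m) \<le> C * q k (y m' - y m)\<close> by linarith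
    qed
    have "q i (y m - y m') < \<epsilon>" if "max N0 N1 \<le> m" "max N0 N1 \<le> m'" for m m'
      using half[of m m'] half[of m' m] that seminorm_minus_commute[OF q_semi yE yE, of i m m']
      by (cases "m \<le> m'") auto
    then show ?thesis by blast
  qed
  obtain l where l: "l \<in> E" "\<And>i. (\<lambda>m. q i (y m - l)) \<longlonglongrightarrow> 0"
    by (rule fundamental_Cauchy_convergent[where f = y, OF fund compl yE Cauchy]) (assumption | blast)+
  have "q k l \<le> q k (y m - l) + q k (y m)" for m
  proof -
    have "q k l \<le> max (q k (l - y m)) (q k (y m))"
      by (rule seminorm_le_max_diff[OF q_semi l(1) yE])
    moreover have "q k (l - y m) = q k (y m - l)" by (rule seminorm_minus_commute[OF q_semi l(1) yE])
    moreover have "0 \<le> q k (y m)" "0 \<le> q k (y m - l)"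
      using seminorm_nonneg[OF q_semi yE] seminorm_nonneg[OF q_semi diff_in_E[OF yE l(1)]] by auto
    ultimately show ?thesis by linarith
  qed
  moreover have "(\<lambda>m. q k (y m - l) + q k (y m)) \<longlonglongrightarrow> 0"
    using tendsto_add[OF l(2) yk] by simp
  ultimately have "q k l \<le> 0" using LIMSEQ_le_const by blast
  then have "q k l = 0" using seminorm_nonneg[OF q_semi l(1), of k] by linarith
  then have "l = 0" by (rule norm[OF l(1)])
  obtain i where "continuous_functional L (q i) (\<phi> n)" using \<phi> by blast
  then have "dominated_on L (\<lambda>x. v (\<phi> n x)) (q i)" unfolding continuous_functional_def by blast
  then obtain C where C: "\<And>x. x \<in> L \<Longrightarrow> v (\<phi> n x) \<le> C * q i x"
    unfolding dominated_on_def by blast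
  have "v (\<phi> n x0) \<le> C * q i (y m)" for m using C[of "y m"] yP[of m] by simp
  moreover have "(\<lambda>m. C * q i (y m)) \<longlonglongrightarrow> 0"
    using tendsto_mult_right_zero[OF l(2)[of i], of C] \<open>l = 0\<close> by simp
  ultimately have "v (\<phi> n x0) \<le> 0" using LIMSEQ_le_const by blast
  then show False using x0(2) valuation_pos by fastforce
qed

text \<open>The uniform choice of \<open>j\<close> is the point. A mere failure of domination on \<open>L\<close> can be due to finitely many
  directions; if this happened for every \<open>j\<close>, enumerating the functionals involved would contradict
  the previous lemma.\<close>
lemma ex_undominated_on_finite_codimension:
  assumes fund: "fundamental T q" and compl: "complete_tvs T"
    and norm: "\<And>x. x \<in> E \<Longrightarrow> q k x = 0 \<Longrightarrow> x = 0"
    and L: "subspace L" "L \<subseteq> E" and not_dom: "\<exists>j. \<not> dominated_on L (q j) (q k)"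
  shows "\<exists>j. \<forall>\<Phi>. finite \<Phi> \<longrightarrow> (\<forall>\<phi>\<in>\<Phi>. \<exists>m. continuous_functional L (q m) \<phi>) \<longrightarrow>
    \<not> dominated_on {x \<in> L. \<forall>\<phi>\<in>\<Phi>. \<phi> x = 0} (q j) (q k)"
proof (rule ccontr)
  assume "\<not> ?thesis"
  then have "\<forall>j. \<exists>\<Phi>. finite \<Phi> \<and> (\<forall>\<phi>\<in>\<Phi>. \<exists>m. continuous_functional L (q m) \<phi>) \<and>
    dominated_on {x \<in> L. \<forall>\<phi>\<in>\<Phi>. \<phi> x = 0} (q j) (q k)" by blast
  from choice[OF this] obtain \<Phi> where \<Phi>: "\<And>j. finite (\<Phi> j)"
    "\<And>j \<phi>. \<phi> \<in> \<Phi> j \<Longrightarrow> \<exists>m. continuous_functional L (q m) \<phi>"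
    "\<And>j. dominated_on {x \<in> L. \<forall>\<phi>\<in>\<Phi> j. \<phi> x = 0} (q j) (q k)" by blast
  define U where "U = insert (\<lambda>_. 0) (\<Union>j. \<Phi> j)"
  have "countable U" unfolding U_def using \<Phi>(1) by (simp add: countable_finite)
  define \<phi> where "\<phi> = from_nat_into U"
  have range_\<phi>: "range \<phi> = U"
    unfolding \<phi>_def using \<open>countable U\<close> by (intro range_from_nat_into) (auto simp: U_def)
  have zero: "continuous_functional L (q 0) (\<lambda>_. 0)"
  proof -
    have "\<forall>x\<in>L. v 0 \<le> 0 * q 0 x" by simp
    then show ?thesis
      unfolding continuous_functional_def linear_on_def dominated_on_def by (intro conjI exI[of _ 0]) auto
  qed
  have cont: "\<exists>m. continuous_functional L (q m) (\<phi> i)" for i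
  proof -
    have "\<phi> i \<in> U" using range_\<phi> by blast
    then consider "\<phi> i = (\<lambda>_. 0)" | j where "\<phi> i \<in> \<Phi> j" unfolding U_def by blast
    then show ?thesis
    proof cases
      case 1
      show ?thesis unfolding 1 using zero by (rule exI)
    next
      case 2
      then show ?thesis by (rule \<Phi>(2))
    qed
  qed
  have chain: "\<exists>n. dominated_on {x \<in> L. \<forall>i<n. \<phi> i x = 0} (q j) (q k)" for j
  proof -
    have "\<Phi> j \<subseteq> range \<phi>" unfolding range_\<phi> U_def by blast
    then obtain I where I: "finite I" "\<Phi> j = \<phi> ` I"
      using finite_subset_image[OF \<Phi>(1)[of j], of \<phi> UNIV] by auto
    obtain n where n: "I \<subseteq> {..<n}" using finite_nat_bounded[OF I(1)] by blast
    have "{x \<in> L. \<forall>i<n. \<phi> i x = 0} \<subseteq> {x \<in> L. \<forall>\<phi>\<in>\<Phi> j. \<phi> x = 0}"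
      using n unfolding I(2) by auto
    then show ?thesis using dominated_on_mono[OF \<Phi>(3)] by blast
  qed
  have "dominated_on L (q j) (q k)" for j
    by (rule dominated_of_kernel_chain[OF fund compl norm L cont chain])
  then show False using not_dom by blast
qed

section \<open>Non-normable subspaces with a Schauder basis\<close>

text \<open>Strictly increasing within \<open>[1, 2]\<close>, so that the factors \<open>weight (Suc n) / weight n\<close> exceed \<open>1\<close> while
  their products stay bounded.\<close>
definition weight :: "nat \<Rightarrow> real" where
  "weight n = 2 - 1 / 2 ^ n"

lemma weight_bounds: "1 \<le> weight n" "weight n \<le> 2" and weight_less: "weight n < weight (Suc n)"
proof -
  have "(1::real) \<le> 2 ^ n" by simp
  then show "1 \<le> weight n" "weight n \<le> 2" "weight n < weight (Suc n)"
    unfolding weight_def by (simp_all add: field_simps)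
qed

text \<open>The vectors are chosen one after the other, the \<open>n\<close>-th one in the joint kernel of functionals that make
  it almost orthogonal to its predecessors for \<open>q 0, \<dots>, q n\<close>, and such that \<open>q k\<close> is smaller than \<open>q (J k)\<close>
  by a factor of more than \<open>n\<close>. Here \<open>k\<close> runs through the first components of the pairs coded by \<open>n\<close>, so
  that every \<open>k\<close> is treated for infinitely many \<open>n\<close>.\<close>
lemma nonnormable_norm_case:
  assumes fund: "fundamental T q" and compl: "complete_tvs T" and Haus: "Hausdorff_space T"
    and norm: "\<And>k x. x \<in> E \<Longrightarrow> q k x = 0 \<Longrightarrow> x = 0" and nonnormable: "\<not> normable v scl T"
  shows "\<exists>D e. subspace D \<and> closedin T D \<and> schauder_basis v scl (subtopology T D) e \<and>
    \<not> normable v scl (subtopology T D)"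
proof -
  note q_semi = fundamental_seminorm[OF fund]
  have "\<forall>k. \<exists>j. \<not> dominated_on E (q j) (q k)"
    using nonnormable normable_fundamental_iff[OF fund Haus] by blast
  then obtain J0 where J0: "\<And>k. \<not> dominated_on E (q (J0 k)) (q k)" by metis
  have "\<exists>y. y \<in> E \<and> C * q k y < q (J0 k) y" for k C
    using J0[of k] unfolding dominated_on_def by (auto simp: not_le)
  then have "\<forall>m. \<exists>y. y \<in> E \<and> real (snd (prod_decode m)) * q (fst (prod_decode m)) y
      < q (J0 (fst (prod_decode m))) y"
    by blast
  \<comment> \<open>The span of the \<open>x m\<close> has countable dimension and still witnesses non-normability.\<close>
  from choice[OF this] obtain x where x: "\<And>m. x m \<in> E \<and>
      real (snd (prod_decode m)) * q (fst (prod_decode m)) (x m) < q (J0 (fst (prod_decode m))) (x m)"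
    by blast
  have xE: "x m \<in> E" for m using x by blast
  define L where "L = span (range x)"
  have L: "subspace L" "L \<subseteq> E"
    unfolding L_def using xE by (simp, intro span_minimal[OF _ subspace_E]) auto
  have "\<not> dominated_on L (q (J0 k)) (q k)" for k
  proof
    assume "dominated_on L (q (J0 k)) (q k)"
    then obtain C where C: "\<And>y. y \<in> L \<Longrightarrow> q (J0 k) y \<le> C * q k y" unfolding dominated_on_def by blast
    obtain n where n: "C \<le> real n" using real_arch_simple by blast
    let ?y = "x (prod_encode (k, n))"
    have "C * q k ?y \<le> real n * q k ?y"
      using n seminorm_nonneg[OF q_semi xE] by (intro mult_right_mono)
    moreover have "?y \<in> L" unfolding L_def by (simp add: span_base)
    ultimately show False using C[of ?y] x[of "prod_encode (k, n)"] by simp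
  qed
  then have L_nondom: "\<exists>j. \<not> dominated_on L (q j) (q k)" for k by blast
  have "\<forall>k. \<exists>j. \<forall>\<Phi>. finite \<Phi> \<longrightarrow> (\<forall>\<phi>\<in>\<Phi>. \<exists>m. continuous_functional L (q m) \<phi>) \<longrightarrow>
    \<not> dominated_on {x \<in> L. \<forall>\<phi>\<in>\<Phi>. \<phi> x = 0} (q j) (q k)"
    by (intro allI ex_undominated_on_finite_codimension[OF fund compl norm L L_nondom])
  from choice[OF this] obtain J where J: "\<And>k \<Phi>. finite \<Phi> \<Longrightarrow>
      \<forall>\<phi>\<in>\<Phi>. \<exists>m. continuous_functional L (q m) \<phi> \<Longrightarrow>
      \<not> dominated_on {x \<in> L. \<forall>\<phi>\<in>\<Phi>. \<phi> x = 0} (q (J k)) (q k)"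
    by blast
  define K where "K n = fst (prod_decode n)" for n
  let ?P = "\<lambda>e n r. r \<in> L \<and> r \<noteq> 0 \<and> real n * q (K n) r < q (J (K n)) r \<and>
    (\<forall>i\<le>n. \<forall>f\<in>span (e ` {..<n}). \<forall>a. weight n * q i f \<le> weight (Suc n) * q i (f + a \<odot> r))"
  have "\<exists>e. \<forall>n. ?P e n (e n)"
  proof (rule dependent_wellorder_choice)
    fix r n and e e' :: "nat \<Rightarrow> 'a" assume "\<And>m. m < n \<Longrightarrow> e m = e' m"
    then have "e ` {..<n} = e' ` {..<n}" by auto
    then show "?P e n r = ?P e' n r" by simp
  next
    fix n and e :: "nat \<Rightarrow> 'a" assume IH: "\<And>m. m < n \<Longrightarrow> ?P e m (e m)"
    define t where "t = weight (Suc n) / weight n"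
    have "0 < weight n" using weight_bounds(1)[of n] by linarith
    then have t: "1 < t" "weight n * t = weight (Suc n)"
      using weight_less[of n] by (simp_all add: t_def)
    have "\<exists>\<Phi>. finite \<Phi> \<and> (\<forall>\<phi>\<in>\<Phi>. continuous_functional L (q i) \<phi>) \<and>
      (\<forall>f\<in>span (e ` {..<n}). \<forall>g\<in>L. (\<forall>\<phi>\<in>\<Phi>. \<phi> g = 0) \<longrightarrow> q i f \<le> t * q i (f + g))" for i
      unfolding L_def using IH by (intro ex_orthogonal_kernel[OF q_semi xE _ t(1)]) (auto simp: L_def)
    then have "\<forall>i. \<exists>\<Phi>. finite \<Phi> \<and> (\<forall>\<phi>\<in>\<Phi>. continuous_functional L (q i) \<phi>) \<and>
      (\<forall>f\<in>span (e ` {..<n}). \<forall>g\<in>L. (\<forall>\<phi>\<in>\<Phi>. \<phi> g = 0) \<longrightarrow> q i f \<le> t * q i (f + g))"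
      by (rule allI)
    from choice[OF this] obtain \<Phi> where \<Phi>_all: "\<forall>i. finite (\<Phi> i) \<and>
      (\<forall>\<phi>\<in>\<Phi> i. continuous_functional L (q i) \<phi>) \<and>
      (\<forall>f\<in>span (e ` {..<n}). \<forall>g\<in>L. (\<forall>\<phi>\<in>\<Phi> i. \<phi> g = 0) \<longrightarrow> q i f \<le> t * q i (f + g))"
      by (elim exE)
    have \<Phi>: "finite (\<Phi> i)" "\<forall>\<phi>\<in>\<Phi> i. continuous_functional L (q i) \<phi>"
      "f \<in> span (e ` {..<n}) \<Longrightarrow> g \<in> L \<Longrightarrow> \<forall>\<phi>\<in>\<Phi> i. \<phi> g = 0 \<Longrightarrow> q i f \<le> t * q i (f + g)" for i f g
      using spec[OF \<Phi>_all, of i] by simp_all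
    define \<Psi> where "\<Psi> = (\<Union>i\<le>n. \<Phi> i)"
    have "finite \<Psi>" unfolding \<Psi>_def using \<Phi>(1) by simp
    moreover have \<Psi>_cont: "\<forall>\<phi>\<in>\<Psi>. \<exists>m. continuous_functional L (q m) \<phi>"
      unfolding \<Psi>_def using \<Phi>(2) by blast
    ultimately have "\<not> dominated_on {x \<in> L. \<forall>\<phi>\<in>\<Psi>. \<phi> x = 0} (q (J (K n))) (q (K n))"
      by (rule J)
    then obtain r where r: "r \<in> L" "\<forall>\<phi>\<in>\<Psi>. \<phi> r = 0" "real n * q (K n) r < q (J (K n)) r"
      unfolding dominated_on_def by (auto simp: not_le)
    have rE: "r \<in> E" using r L by blast
    have "0 \<le> real n * q (K n) r" using seminorm_nonneg[OF q_semi rE] by simp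
    then have "r \<noteq> 0" using r(3) seminorm_zero[OF q_semi] by auto
    moreover have "weight n * q i f \<le> weight (Suc n) * q i (f + a \<odot> r)"
      if i: "i \<le> n" and f: "f \<in> span (e ` {..<n})" for i f a
    proof -
      have "\<phi> (a \<odot> r) = 0" if "\<phi> \<in> \<Phi> i" for \<phi>
      proof -
        have "\<phi> \<in> \<Psi>" using that i unfolding \<Psi>_def by blast
        moreover have "linear_on L \<phi>"
          using \<Phi>(2) that unfolding continuous_functional_def by blast
        ultimately show ?thesis using r linear_on_scale by fastforce
      qed
      then have "q i f \<le> t * q i (f + a \<odot> r)"
        using f subspace_scale[OF L(1) r(1)] by (intro \<Phi>(3)) auto
      then have "weight n * q i f \<le> weight n * (t * q i (f + a \<odot> r))"
        using \<open>0 < weight n\<close> by simp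
      then show ?thesis using t(2) by (simp add: mult.assoc[symmetric])
    qed
    ultimately show "\<exists>r. ?P e n r" using r by blast
  qed
  then obtain e where e: "\<And>n. ?P e n (e n)" by blast
  have eE: "e n \<in> E" for n using e[of n] L by blast
  show ?thesis
  proof (rule ex_nonnormable_subspace_with_basis[OF fund Haus eE weight_bounds])
    fix i n f a assume "i \<le> n" "f \<in> span (e ` {..<n})"
    then show "weight n * q i f \<le> weight (Suc n) * q i (f + a \<odot> e n)" using e[of n] by blast
  next
    fix n
    have "q (Suc n) (e n) \<noteq> 0" using e[of n] norm[OF eE] by blast
    then show "0 < q (Suc n) (e n)" using seminorm_nonneg[OF q_semi eE, of "Suc n" n] by linarith
  next
    fix k
    have "\<exists>n. C * q k (e n) < q (J k) (e n)" for C
    proof -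
      obtain m where m: "C \<le> real m" using real_arch_simple by blast
      define n where "n = prod_encode (k, m)"
      have "m \<le> n" unfolding n_def by (rule le_prod_encode_2)
      then have "C * q k (e n) \<le> real n * q k (e n)"
        using m by (intro mult_right_mono seminorm_nonneg[OF q_semi eE]) auto
      moreover have "K n = k" by (simp add: K_def n_def)
      then have "real n * q k (e n) < q (J k) (e n)" using e[of n] by simp
      ultimately show ?thesis by (intro exI[of _ n]) linarith
    qed
    then show "\<exists>j. \<forall>C. \<exists>n. C * q k (e n) < q j (e n)" by blast
  qed
qed

text \<open>Choose indices \<open>s 0 < s 1 < \<dots>\<close> and vectors with \<open>q (s n) (e n) = 0 < q (s (Suc n)) (e n)\<close>. Adding
  multiples of \<open>e n\<close> does not change \<open>q (s i)\<close> for \<open>i \<le> n\<close>, so orthogonality holds with constant weights.\<close>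
lemma nonnormable_no_norm_case:
  assumes fund: "fundamental T q" and Haus: "Hausdorff_space T"
    and no_norm: "\<And>k. \<exists>x\<in>E. q k x = 0 \<and> x \<noteq> 0"
  shows "\<exists>D e. subspace D \<and> closedin T D \<and> schauder_basis v scl (subtopology T D) e \<and>
    \<not> normable v scl (subtopology T D)"
proof -
  let ?P = "\<lambda>(n::nat) z. snd z \<in> E \<and> q (fst z) (snd z) = 0 \<and> snd z \<noteq> 0"
  let ?Q = "\<lambda>(n::nat) z z'. fst z < fst z' \<and> 0 < q (fst z') (snd z)"
  have "\<exists>f. \<forall>n. ?P n (f n) \<and> ?Q n (f n) (f (Suc n))"
  proof (rule dependent_nat_choice)
    show "\<exists>z. ?P 0 z" using no_norm[of 0] by auto
  next
    fix z :: "nat \<times> 'a" and n assume z: "?P n z"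
    then obtain m where "q m (snd z) \<noteq> 0" using Hausdorff_fundamental[OF fund Haus] by blast
    then have m: "0 < q m (snd z)"
      using z seminorm_nonneg[OF fundamental_seminorm[OF fund], of "snd z" m] by force
    define s where "s = max m (Suc (fst z))"
    have "q m (snd z) \<le> q s (snd z)" using z by (intro fundamental_mono[OF fund]) (auto simp: s_def)
    then have "0 < q s (snd z)" using m by linarith
    moreover have "fst z < s" by (simp add: s_def)
    moreover obtain y where "y \<in> E" "q s y = 0" "y \<noteq> 0" using no_norm by blast
    ultimately show "\<exists>z'. ?P (Suc n) z' \<and> ?Q n z z'" by (intro exI[of _ "(s, y)"]) auto
  qed
  then obtain f where f: "\<And>n. ?P n (f n)" "\<And>n. ?Q n (f n) (f (Suc n))" by blast
  define s e where "s n = fst (f n)" and "e n = snd (f n)" for n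
  have e: "e n \<in> E" "q (s n) (e n) = 0" "0 < q (s (Suc n)) (e n)" for n
    using f by (auto simp: s_def e_def)
  have mono: "strict_mono s" unfolding strict_mono_Suc_iff using f(2) by (simp add: s_def)
  have fund': "fundamental T (\<lambda>n. q (s n))" by (rule fundamental_subsequence[OF fund mono])
  note semi = fundamental_seminorm[OF fund]
  show ?thesis
  proof (rule ex_nonnormable_subspace_with_basis[OF fund' Haus e(1), of "\<lambda>_. 1"])
    fix i n g a assume i: "i \<le> n" and g: "g \<in> span (e ` {..<n})"
    have gE: "g \<in> E" using g e(1) span_minimal[OF _ subspace_E, of "e ` {..<n}"] by blast
    have "q (s i) (e n) \<le> q (s n) (e n)"
      using i by (intro fundamental_mono[OF fund'] e)
    then have "q (s i) (e n) = 0" using e seminorm_nonneg[OF semi e(1), of "s i" n] by force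
    then have "q (s i) (a \<odot> e n) = 0" by (simp add: seminorm_scale[OF semi e(1)])
    moreover have "q (s i) ((g + a \<odot> e n) - a \<odot> e n) \<le> max (q (s i) (g + a \<odot> e n)) (q (s i) (a \<odot> e n))"
      by (intro seminorm_diff[OF semi] add_in_E scale_in_E gE e)
    moreover have "0 \<le> q (s i) (g + a \<odot> e n)"
      by (intro seminorm_nonneg[OF semi] add_in_E scale_in_E gE e)
    ultimately show "1 * q (s i) g \<le> 1 * q (s i) (g + a \<odot> e n)" by simp
  next
    fix k
    have "\<forall>C. C * q (s k) (e k) < q (s (Suc k)) (e k)" using e by simp
    then show "\<exists>j. \<forall>C. \<exists>n. C * q (s k) (e n) < q (s j) (e n)" by blast
  qed (use e in auto)
qed

end

theorem theorem2p0p4: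
  fixes v :: "'k::field \<Rightarrow> real"
    and scl :: "'k \<Rightarrow> 'a::ab_group_add \<Rightarrow> 'a"
    and X :: "'a topology"
  assumes "complete_nonarch_field v"
    and "frechet_space v scl X"
  shows "normable v scl X \<longleftrightarrow>
    (\<forall>D. module.subspace scl D \<and> closedin X D \<and>
         (\<exists>e. schauder_basis v scl (subtopology X D) e) \<longrightarrow>
         normable v scl (subtopology X D))"
proof -
  have lcs: "locally_convex_space v scl X" and metr: "metrizable_space X" and compl: "complete_tvs X"
    using assms(2) unfolding frechet_space_def by auto
  have vs: "vector_space scl" and sub: "module.subspace scl (topspace X)" and Haus: "Hausdorff_space X"
    using lcs unfolding locally_convex_space_def by auto
  obtain P where P: "\<And>p. p \<in> P \<Longrightarrow> nonarch_seminorm_on v scl (topspace X) p"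
    "X = seminorm_topology (topspace X) P"
    using lcs unfolding locally_convex_space_def by blast
  interpret X: nonarch_space scl v "topspace X"
    by (rule nonarch_space.intro[OF vs]) (unfold_locales, rule assms(1), rule sub)
  obtain q where q: "X.fundamental X q"
    by (rule X.ex_fundamental[OF P metr]) blast
  show ?thesis
  proof
    assume "normable v scl X"
    then obtain k where k: "\<And>j. X.dominated_on (topspace X) (q j) (q k)"
      using X.normable_fundamental_iff[OF q Haus] by blast
    show "\<forall>D. module.subspace scl D \<and> closedin X D \<and>
         (\<exists>e. schauder_basis v scl (subtopology X D) e) \<longrightarrow> normable v scl (subtopology X D)"
    proof (intro allI impI, elim conjE)
      fix D assume D: "X.subspace D" "closedin X D"
      then have DX: "D \<subseteq> topspace X" by (simp add: closedin_subset)
      interpret D: nonarch_space scl v D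
        by (rule nonarch_space.intro[OF vs]) (unfold_locales, rule assms(1), rule D(1))
      have "D.fundamental (subtopology X D) q" by (rule X.fundamental_subtopology[OF q D(1) DX])
      moreover have "Hausdorff_space (subtopology X D)" using Haus by (rule Hausdorff_space_subtopology)
      moreover have "D.dominated_on D (q j) (q k)" for j
        using X.dominated_on_mono[OF k DX] .
      ultimately show "normable v scl (subtopology X D)"
        using D.normable_fundamental_iff by blast
    qed
  next
    assume sub: "\<forall>D. module.subspace scl D \<and> closedin X D \<and>
         (\<exists>e. schauder_basis v scl (subtopology X D) e) \<longrightarrow> normable v scl (subtopology X D)"
    show "normable v scl X"
    proof (rule ccontr)
      assume nonnormable: "\<not> normable v scl X"
      have "\<exists>D e. X.subspace D \<and> closedin X D \<and> schauder_basis v scl (subtopology X D) e \<and>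
        \<not> normable v scl (subtopology X D)"
      proof (cases "\<exists>k. \<forall>x\<in>topspace X. q k x = 0 \<longrightarrow> x = 0")
        case True
        then obtain k where k: "\<And>x. x \<in> topspace X \<Longrightarrow> q k x = 0 \<Longrightarrow> x = 0" by blast
        \<comment> \<open>From a seminorm that is a norm onwards, all of them are norms.\<close>
        have q': "X.fundamental X (\<lambda>n. q (k + n))"
          by (rule X.fundamental_subsequence[OF q]) (simp add: strict_mono_def)
        have "x = 0" if x: "x \<in> topspace X" "q (k + n) x = 0" for n x
        proof (rule k[OF x(1)])
          have "q k x \<le> q (k + n) x" by (rule X.fundamental_mono[OF q le_add1 x(1)])
          then show "q k x = 0"
            using x X.seminorm_nonneg[OF X.fundamental_seminorm[OF q] x(1), of k] by linarith
        qed
        then show ?thesis by (rule X.nonnormable_norm_case[OF q' compl Haus _ nonnormable])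
      next
        case False
        then show ?thesis by (intro X.nonnormable_no_norm_case[OF q Haus]) blast
      qed
      then show False using sub by blast
    qed
  qed
qed

end
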